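(* Assume $\omega_1<\mathfrak b=\mathfrak s=\mathfrak c$. Then there exists an $\mathbb R$-rigid Nyikos space.
   Context: $\mathfrak c$ is the cardinality of the continuum. $\mathfrak b$ is the least cardinality of a family $\Phi\subseteq\omega^\omega$ such that no $g\in\omega^\omega$ satisfies $f(n)\le g(n)$ for all but finitely many $n$, for every $f\in\Phi$. $\mathfrak s$ is the least cardinality of a family $\mathcal S$ of infinite subsets of $\omega$ such that for every infinite $A\subseteq\omega$ some $S\in\mathcal S$ has $A\cap S$ and $A\setminus S$ both infinite. A space is countably compact if each closed discrete subset of it is finite. A Nyikos space is a regular separable first-countable countably compact space. A space is $\mathbb R$-rigid if every continuous real-valued function on it is constant. *)

theory Defs
  imports "HOL-Analysis.Analysis"
begin

unbundle cardinal_syntax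

section \<open>Cardinal characteristics\<close>

text \<open>The least cardinality of a set with property \<open>P\<close>, as a cardinal order.
  It is meaningful only up to order isomorphism \<open>=o\<close>, and only if some set satisfies \<open>P\<close>.\<close>

definition least_card :: "('a set \<Rightarrow> bool) \<Rightarrow> 'a rel" where
  "least_card P = (SOME r. (\<exists>F. P F \<and> r = |F| ) \<and> (\<forall>F. P F \<longrightarrow> r \<le>o |F| ))"

lemma least_card:
  assumes "P F0"
  shows "\<exists>F. P F \<and> least_card P = |F|" and "P F \<Longrightarrow> least_card P \<le>o |F|"
proof -
  have "\<exists>r \<in> card_of ` Collect P. \<forall>r' \<in> card_of ` Collect P. r \<le>o r'"
    using assms by (intro exists_minim_Card_order) (auto simp: card_of_Card_order)
  then have "\<exists>r. (\<exists>F. P F \<and> r = |F| ) \<and> (\<forall>F. P F \<longrightarrow> r \<le>o |F| )"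
    by blast
  from someI_ex[OF this]
  show "\<exists>F. P F \<and> least_card P = |F|" and "P F \<Longrightarrow> least_card P \<le>o |F|"
    unfolding least_card_def by blast+
qed

definition unbounded_family :: "(nat \<Rightarrow> nat) set \<Rightarrow> bool" where
  "unbounded_family \<Phi> \<longleftrightarrow> \<not> (\<exists>g. \<forall>f\<in>\<Phi>. \<forall>\<^sub>\<infinity>n. f n \<le> g n)"

definition splitting_family :: "nat set set \<Rightarrow> bool" where
  "splitting_family \<S> \<longleftrightarrow> (\<forall>S\<in>\<S>. infinite S) \<and>
     (\<forall>A. infinite A \<longrightarrow> (\<exists>S\<in>\<S>. infinite (A \<inter> S) \<and> infinite (A - S)))"

definition bounding_number :: "(nat \<Rightarrow> nat) rel" where
  "bounding_number = least_card unbounded_family"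

definition splitting_number :: "nat set rel" where
  "splitting_number = least_card splitting_family"

definition continuum :: "real rel" where
  "continuum = |UNIV :: real set|"

definition omega1 :: "nat set rel" where
  "omega1 = cardSuc natLeq"

lemma unbounded_family_UNIV: "unbounded_family UNIV"
proof -
  have "\<exists>f. \<not> (\<forall>\<^sub>\<infinity>n. f n \<le> g n)" for g :: "nat \<Rightarrow> nat"
    by (rule exI[of _ "\<lambda>n. Suc (g n)"]) simp
  then show ?thesis
    unfolding unbounded_family_def by blast
qed

lemma splitting_family_infinite: "splitting_family (Collect infinite)"
  unfolding splitting_family_def
proof (intro conjI allI impI)
  fix A :: "nat set"
  assume "infinite A"
  then obtain e :: "nat \<Rightarrow> nat" where e: "inj e" "range e \<subseteq> A"
    using infinite_countable_subset by blast
  define S where "S = e ` range (\<lambda>n. 2 * n)"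
  have "infinite (range (\<lambda>n::nat. 2 * n))" "infinite (range (\<lambda>n::nat. Suc (2 * n)))"
    by (auto intro!: range_inj_infinite injI)
  then have "infinite S" "infinite (e ` range (\<lambda>n::nat. Suc (2 * n)))"
    unfolding S_def using e(1) by (meson finite_imageD inj_on_subset subset_UNIV)+
  moreover have "e ` range (\<lambda>n::nat. Suc (2 * n)) \<subseteq> A - S"
    using e unfolding S_def by (auto simp: inj_eq; presburger)
  moreover have "S \<subseteq> A"
    using e unfolding S_def by auto
  ultimately have "S \<subseteq> A" "infinite S" "infinite (A - S)"
    using infinite_super by blast+
  then show "\<exists>S\<in>Collect infinite. infinite (A \<inter> S) \<and> infinite (A - S)"
    by (auto simp: Int_absorb1)
qed auto

section \<open>Spaces\<close>

definition countably_compact_space :: "'a topology \<Rightarrow> bool" where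
  "countably_compact_space X \<longleftrightarrow>
     (\<forall>D. closedin X D \<and> subtopology X D = discrete_topology D \<longrightarrow> finite D)"

text \<open>Regular spaces are understood to be Hausdorff.\<close>

definition Nyikos_space :: "'a topology \<Rightarrow> bool" where
  "Nyikos_space X \<longleftrightarrow>
     Hausdorff_space X \<and> regular_space X \<and> separable_space X \<and> first_countable X \<and>
     countably_compact_space X"

definition R_rigid :: "'a topology \<Rightarrow> bool" where
  "R_rigid X \<longleftrightarrow>
     (\<forall>f. continuous_map X euclideanreal f \<longrightarrow> (\<exists>c. \<forall>x\<in>topspace X. f x = c))"

text \<open>Separable first-countable Hausdorff spaces have at most continuum many points,
  so quantifying over topologies on subsets of \<open>real\<close> covers all Nyikos spaces up to
  homeomorphism.\<close>

lemma Nyikos_space_on_reals: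
  fixes X :: "'a topology"
  assumes "Nyikos_space X"
  shows "\<exists>Y :: real topology. X homeomorphic_space Y"
proof -
  have H: "Hausdorff_space X" and S: "separable_space X" and C: "first_countable X"
    using assms by (auto simp: Nyikos_space_def)
  from S obtain D where D: "countable D" "D \<subseteq> topspace X" "X closure_of D = topspace X"
    unfolding separable_space_def by blast
  have "\<exists>U :: nat \<Rightarrow> 'a set. (\<forall>n. openin X (U n) \<and> x \<in> U n) \<and>
          (\<forall>V. openin X V \<and> x \<in> V \<longrightarrow> (\<exists>n. U n \<subseteq> V))" if x: "x \<in> topspace X" for x
  proof -
    obtain B where B: "countable B" "\<forall>V\<in>B. openin X V"
      "\<forall>V. openin X V \<and> x \<in> V \<longrightarrow> (\<exists>W\<in>B. x \<in> W \<and> W \<subseteq> V)"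
      using C x unfolding first_countable_def by meson
    define B' where "B' = {W\<in>B. x \<in> W}"
    have "countable B'" "B' \<noteq> {}"
      using B x openin_topspace by (auto simp: B'_def)
    then have r: "range (from_nat_into B') = B'"
      by (simp add: range_from_nat_into)
    show ?thesis
    proof (intro exI[of _ "from_nat_into B'"] conjI allI impI)
      fix n
      have "from_nat_into B' n \<in> B'"
        using r by blast
      then show "openin X (from_nat_into B' n)" "x \<in> from_nat_into B' n"
        using B by (auto simp: B'_def)
    next
      fix V assume "openin X V \<and> x \<in> V"
      then obtain W where "W \<in> B'" "W \<subseteq> V"
        using B by (auto simp: B'_def)
      then show "\<exists>n. from_nat_into B' n \<subseteq> V"
        using r by (metis imageE)
    qed
  qed
  then obtain U :: "'a \<Rightarrow> nat \<Rightarrow> 'a set" where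
    U: "\<And>x n. x \<in> topspace X \<Longrightarrow> openin X (U x n) \<and> x \<in> U x n" and
    Ub: "\<And>x V. x \<in> topspace X \<Longrightarrow> openin X V \<Longrightarrow> x \<in> V \<Longrightarrow> \<exists>n. U x n \<subseteq> V"
    by metis
  define h where "h x = {prod_encode (n, to_nat_on D d) | n d. d \<in> D \<and> d \<in> U x n}" for x
  have hU: "U x n \<inter> D \<subseteq> U y n" if "h x = h y" for x y n
  proof
    fix d assume d: "d \<in> U x n \<inter> D"
    then have "prod_encode (n, to_nat_on D d) \<in> h y"
      using that unfolding h_def by blast
    then obtain d' where "d' \<in> D" "d' \<in> U y n" "to_nat_on D d = to_nat_on D d'"
      by (auto simp: h_def)
    then show "d \<in> U y n"
      using D d by (metis IntD2 to_nat_on_inj)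
  qed
  have injh: "inj_on h (topspace X)"
  proof (rule inj_onI, rule ccontr)
    fix x y assume x: "x \<in> topspace X" and y: "y \<in> topspace X" and e: "h x = h y" and ne: "x \<noteq> y"
    then obtain V W where VW: "openin X V" "openin X W" "x \<in> V" "y \<in> W" "disjnt V W"
      using H unfolding Hausdorff_space_def by meson
    obtain k n where kn: "U x k \<subseteq> V" "U y n \<subseteq> W"
      using Ub x y VW by meson
    have "openin X (U x k \<inter> U x n)" "x \<in> U x k \<inter> U x n"
      using U x by auto
    moreover have "x \<in> X closure_of D"
      using D x by simp
    ultimately obtain d where "d \<in> D" "d \<in> U x k" "d \<in> U x n"
      unfolding in_closure_of by blast
    then have "d \<in> V" "d \<in> W"
      using kn hU[OF e, of n] by auto
    then show False
      using VW by (auto simp: disjnt_iff)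
  qed
  obtain j :: "nat set \<Rightarrow> real" where j: "inj j"
    using nat_sets_eqpoll_reals by (auto simp: eqpoll_def bij_betw_def)
  define f where "f = j \<circ> h"
  have injf: "inj_on f (topspace X)"
    unfolding f_def using injh j by (auto intro: comp_inj_on inj_on_subset)
  define g where "g = inv_into (topspace X) f"
  have gf: "g (f x) = x" if "x \<in> topspace X" for x
    using injf that by (simp add: g_def)
  define Y where "Y = pullback_topology (f ` topspace X) g X"
  have tY: "topspace Y = f ` topspace X"
    using gf by (auto simp: Y_def topspace_pullback_topology)
  have "continuous_map X X (g \<circ> f)"
    by (rule continuous_map_eq[of _ _ id]) (auto simp: gf)
  then have "continuous_map X Y f"
    unfolding Y_def by (intro continuous_map_pullback') auto
  moreover have "continuous_map Y X g"
    unfolding Y_def using continuous_map_pullback[of X X id "f ` topspace X" g] by simp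
  ultimately have "homeomorphic_maps X Y f g"
    using gf tY by (auto simp: homeomorphic_maps_def)
  then show ?thesis
    unfolding homeomorphic_space_def by blast
qed

end

theory Submission
  imports Defs "HOL-Library.Countable_Set_Type"
begin

text \<open>
  A Luzin almost disjoint family \<open>A a\<close> (\<open>a < \<omega>\<^sub>1\<close>) has the property that a continuous real function on
  its Mrowka space is constant on all but countably many of the points \<open>a\<close>. Take countably many
  copies of \<open>\<omega>\<close>, the cells, joined into a connected graph by the Luzin points, so that all cells get the
  same value, and let every point of every cell be a limit of a sequence of further cells. This gives
  an \<open>\<real>\<close>-rigid separable regular first-countable space with \<open>\<omega>\<^sub>1 < \<cc>\<close> points.

  It is then embedded as a dense subspace into a countably compact one by a recursion of length \<open>\<cc>\<close>. Given a closed
  discrete sequence \<open>s\<close> in a space with fewer than \<open>\<cc>\<close> points, \<open>\<ss> = \<cc>\<close> yields a subsequence split by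
  no basic neighbourhood, and \<open>\<bb> = \<cc>\<close> yields \<open>g\<close> such that the sets \<open>\<Union>n\<ge>m. N (s n) (g n + m)\<close> are
  neighbourhoods of a new limit point; the new point is put into the old neighbourhoods containing
  almost all of the subsequence. Inclusion and disjointness of basic neighbourhoods persist, so that
  regularity survives at limit stages.
\<close>

section \<open>Topologies from neighbourhood systems\<close>

text \<open>Enlarging a space changes the closures of its old sets, so regularity phrased through
  closures need not survive a limit stage. Hence each axiom below concerns at most two points and is
  witnessed by an inclusion or a disjointness of two basic sets, or by a membership among old
  points. An old inclusion fails only if a new point enters the smaller set alone, an old
  disjointness only if it enters both sets; letting almost all terms of a sequence decide excludes
  both. The unsplit subsequence is there because undecided sets are fatal: a set
  \<open>N x m\<close> missing infinitely many terms cannot receive the new point, and if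
  \<open>N x (Suc m)\<close> still contained infinitely many of them, the point would lie in its
  closure. Both cardinal hypotheses are applied to families indexed by pairs of a point and a
  number, which is why the space to be embedded must have fewer than \<cc> points. Rigidity passes
  to the result because a continuous function restricts to a constant on a dense set.\<close>

locale nbhd_system =
  fixes P :: "'a set" and N :: "'a \<Rightarrow> nat \<Rightarrow> 'a set"
  assumes sub: "x \<in> P \<Longrightarrow> N x m \<subseteq> P"
    and self: "x \<in> P \<Longrightarrow> x \<in> N x m"
    and dec: "x \<in> P \<Longrightarrow> N x (Suc m) \<subseteq> N x m"
    and op: "x \<in> P \<Longrightarrow> y \<in> N x m \<Longrightarrow> \<exists>k. N y k \<subseteq> N x m"
    and reg: "x \<in> P \<Longrightarrow> y \<in> P \<Longrightarrow> y \<notin> N x m \<Longrightarrow> \<exists>k. N y k \<inter> N x (Suc m) = {}"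
    and sep: "x \<in> P \<Longrightarrow> y \<in> P \<Longrightarrow> x \<noteq> y \<Longrightarrow> \<exists>m. y \<notin> N x m"
begin

lemma antimono: "x \<in> P \<Longrightarrow> m \<le> k \<Longrightarrow> N x k \<subseteq> N x m"
  using lift_Suc_antimono_le[of "N x" m k] dec by blast

definition nbhd_top :: "'a topology" where
  "nbhd_top = topology (\<lambda>U. U \<subseteq> P \<and> (\<forall>x\<in>U. \<exists>m. N x m \<subseteq> U))"

lemma openin_top: "openin nbhd_top U \<longleftrightarrow> U \<subseteq> P \<and> (\<forall>x\<in>U. \<exists>m. N x m \<subseteq> U)"
proof -
  have "istopology (\<lambda>U. U \<subseteq> P \<and> (\<forall>x\<in>U. \<exists>m. N x m \<subseteq> U))"
    unfolding istopology_def
  proof (intro conjI allI impI)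
    fix S T assume S: "S \<subseteq> P \<and> (\<forall>x\<in>S. \<exists>m. N x m \<subseteq> S)" and T: "T \<subseteq> P \<and> (\<forall>x\<in>T. \<exists>m. N x m \<subseteq> T)"
    show "S \<inter> T \<subseteq> P" using S by blast
    show "\<forall>x\<in>S \<inter> T. \<exists>m. N x m \<subseteq> S \<inter> T"
    proof
      fix x assume x: "x \<in> S \<inter> T"
      with S T obtain m k where "N x m \<subseteq> S" "N x k \<subseteq> T" by blast
      moreover have "N x (max m k) \<subseteq> N x m" "N x (max m k) \<subseteq> N x k"
        using x S by (meson IntD1 antimono max.cobounded1 max.cobounded2 subsetD)+
      ultimately show "\<exists>m. N x m \<subseteq> S \<inter> T" by blast
    qed
  next
    fix K assume K: "\<forall>S\<in>K. S \<subseteq> P \<and> (\<forall>x\<in>S. \<exists>m. N x m \<subseteq> S)"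
    then show "\<Union>K \<subseteq> P" by blast
    show "\<forall>x\<in>\<Union>K. \<exists>m. N x m \<subseteq> \<Union>K"
    proof
      fix x assume "x \<in> \<Union>K"
      then obtain S where S: "S \<in> K" "x \<in> S" by blast
      with K obtain m where "N x m \<subseteq> S" by blast
      with S show "\<exists>m. N x m \<subseteq> \<Union>K" by blast
    qed
  qed
  then show ?thesis by (simp add: nbhd_top_def)
qed

lemma openin_N: "x \<in> P \<Longrightarrow> openin nbhd_top (N x m)"
  using sub op by (auto simp: openin_top)

lemma topspace_top [simp]: "topspace nbhd_top = P"
proof
  show "topspace nbhd_top \<subseteq> P" using openin_top openin_topspace by blast
  have "openin nbhd_top P" using sub by (auto simp: openin_top)
  then show "P \<subseteq> topspace nbhd_top" by (rule openin_subset)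
qed

lemma in_closure_of_top: "y \<in> nbhd_top closure_of S \<longleftrightarrow> y \<in> P \<and> (\<forall>k. N y k \<inter> S \<noteq> {})"
proof (intro iffI conjI allI)
  assume "y \<in> nbhd_top closure_of S"
  then have y: "y \<in> P" "\<And>T. y \<in> T \<Longrightarrow> openin nbhd_top T \<Longrightarrow> \<exists>z\<in>S. z \<in> T"
    unfolding in_closure_of by auto
  then show "y \<in> P" by simp
  show "N y k \<inter> S \<noteq> {}" for k
    using y(2)[OF self openin_N] y(1) by blast
next
  assume "y \<in> P \<and> (\<forall>k. N y k \<inter> S \<noteq> {})"
  then show "y \<in> nbhd_top closure_of S"
    unfolding in_closure_of topspace_top openin_top by blast
qed

lemma Hausdorff_top: "Hausdorff_space nbhd_top"
  unfolding Hausdorff_space_def topspace_top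
proof (intro allI impI)
  fix x y assume a: "x \<in> P \<and> y \<in> P \<and> x \<noteq> y"
  then obtain m where "y \<notin> N x m" using sep by blast
  with a obtain k where "N y k \<inter> N x (Suc m) = {}" using reg by blast
  then have "disjnt (N x (Suc m)) (N y k)" by (auto simp: disjnt_def)
  with a openin_N self show "\<exists>U V. openin nbhd_top U \<and> openin nbhd_top V \<and> x \<in> U \<and> y \<in> V \<and> disjnt U V"
    by metis
qed

text \<open>Axiom \<open>reg\<close> says that the closure of \<open>N x (Suc m)\<close> lies in
  \<open>N x m\<close>.\<close>

lemma regular_top: "regular_space nbhd_top"
proof -
  have "\<exists>U V. openin nbhd_top U \<and> openin nbhd_top V \<and> x \<in> U \<and> C \<subseteq> V \<and> disjnt U V"
    if C: "closedin nbhd_top C" and x: "x \<in> P" "x \<notin> C" for C x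
  proof -
    have "openin nbhd_top (P - C)" using C by (simp add: closedin_def)
    with x obtain m where m: "N x m \<subseteq> P - C" unfolding openin_top by blast
    define V where "V = P - nbhd_top closure_of (N x (Suc m))"
    have "C \<subseteq> P" using C closedin_subset by fastforce
    have "C \<subseteq> V"
    proof
      fix y assume "y \<in> C"
      with m \<open>C \<subseteq> P\<close> have "y \<in> P" "y \<notin> N x m" by blast+
      moreover obtain k where "N y k \<inter> N x (Suc m) = {}"
        using reg[OF x(1) \<open>y \<in> P\<close> \<open>y \<notin> N x m\<close>] by blast
      ultimately show "y \<in> V" unfolding V_def by (auto simp: in_closure_of_top)
    qed
    moreover have "openin nbhd_top V"
      unfolding V_def by (metis closedin_closure_of closedin_def topspace_top)
    moreover have "disjnt (N x (Suc m)) V"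
      using closure_of_subset[of "N x (Suc m)" nbhd_top] sub x unfolding V_def disjnt_def topspace_top
      by blast
    ultimately show ?thesis using openin_N[OF x(1)] self[OF x(1)] by metis
  qed
  then show ?thesis unfolding regular_space_def by auto
qed

lemma first_countable_top: "first_countable nbhd_top"
  unfolding first_countable_def topspace_top
proof
  fix x assume x: "x \<in> P"
  show "\<exists>B. countable B \<and> (\<forall>V\<in>B. openin nbhd_top V) \<and>
         (\<forall>U. openin nbhd_top U \<and> x \<in> U \<longrightarrow> (\<exists>V\<in>B. x \<in> V \<and> V \<subseteq> U))"
  proof (intro exI[of _ "range (N x)"] conjI)
    show "\<forall>V\<in>range (N x). openin nbhd_top V" using openin_N[OF x] by blast
    show "\<forall>U. openin nbhd_top U \<and> x \<in> U \<longrightarrow> (\<exists>V\<in>range (N x). x \<in> V \<and> V \<subseteq> U)"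
      using self[OF x] unfolding openin_top by blast
  qed auto
qed

lemma separable_top:
  assumes "countable Q" "Q \<subseteq> P" "\<And>x m. x \<in> P \<Longrightarrow> N x m \<inter> Q \<noteq> {}"
  shows "separable_space nbhd_top"
  unfolding separable_space_def
  using assms by (intro exI[of _ Q]) (auto simp: in_closure_of_top)

text \<open>An accumulation point of a sequence in a closed discrete set lies in that set and has a
  neighbourhood meeting it in no other point, but an injective sequence visits a point at most
  once.\<close>

lemma countably_compact_top:
  assumes acc: "\<And>s :: nat \<Rightarrow> 'a. inj s \<Longrightarrow> range s \<subseteq> P \<Longrightarrow> \<exists>y\<in>P. \<forall>m. infinite {n. s n \<in> N y m}"
  shows "countably_compact_space nbhd_top"
  unfolding countably_compact_space_def
proof (intro allI impI, rule ccontr)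
  fix D assume D: "closedin nbhd_top D \<and> subtopology nbhd_top D = discrete_topology D" and "infinite D"
  then obtain s :: "nat \<Rightarrow> 'a" where s: "inj s" "range s \<subseteq> D"
    using infinite_countable_subset by blast
  have "D \<subseteq> P" using D closedin_subset by fastforce
  with acc s obtain y where y: "y \<in> P" and inf: "\<And>m. infinite {n. s n \<in> N y m}" by blast
  have "s n \<in> D" for n using s by blast
  have "N y k \<inter> D \<noteq> {}" for k
    using inf[of k] \<open>\<And>n. s n \<in> D\<close> by (metis (mono_tags, lifting) Collect_empty_eq IntI emptyE finite.emptyI)
  with y have "y \<in> D" using D by (metis closure_of_closedin in_closure_of_top)
  with D have "openin (subtopology nbhd_top D) {y}" by simp
  then obtain U where "openin nbhd_top U" "U \<inter> D = {y}"
    unfolding openin_subtopology by blast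
  with \<open>y \<in> D\<close> obtain m where m: "N y m \<subseteq> U" unfolding openin_top by blast
  have "{n. s n \<in> N y m} \<subseteq> s -` {y}" using m \<open>U \<inter> D = {y}\<close> \<open>\<And>n. s n \<in> D\<close> by blast
  moreover have "finite (s -` {y})" using s by (simp add: finite_vimageI)
  ultimately show False using inf finite_subset by blast
qed

lemma continuous_map_top:
  "continuous_map nbhd_top euclideanreal f \<longleftrightarrow> (\<forall>x\<in>P. \<forall>e>0. \<exists>m. \<forall>y\<in>N x m. \<bar>f y - f x\<bar> < e)"
proof (intro iffI ballI allI impI)
  fix x e assume f: "continuous_map nbhd_top euclideanreal f" and x: "x \<in> P" and e: "e > (0::real)"
  have "openin nbhd_top {y \<in> P. f y \<in> ball (f x) e}"
    using openin_continuous_map_preimage[OF f, of "ball (f x) e"] by simp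
  moreover have "x \<in> {y \<in> P. f y \<in> ball (f x) e}" using x e by simp
  ultimately obtain m where "N x m \<subseteq> {y \<in> P. f y \<in> ball (f x) e}" unfolding openin_top by blast
  then have "\<forall>y\<in>N x m. \<bar>f y - f x\<bar> < e" by (auto simp: dist_real_def abs_minus_commute)
  then show "\<exists>m. \<forall>y\<in>N x m. \<bar>f y - f x\<bar> < e" ..
next
  assume c: "\<forall>x\<in>P. \<forall>e>0. \<exists>m. \<forall>y\<in>N x m. \<bar>f y - f x\<bar> < e"
  show "continuous_map nbhd_top euclideanreal f"
    unfolding continuous_map_def
  proof (intro conjI allI impI)
    fix U assume "openin euclideanreal U"
    then have U: "open U" by simp
    show "openin nbhd_top {x \<in> topspace nbhd_top. f x \<in> U}"
      unfolding openin_top topspace_top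
    proof (intro conjI ballI)
      fix x assume x: "x \<in> {x \<in> P. f x \<in> U}"
      then obtain e where e: "e > 0" "\<forall>z. \<bar>z - f x\<bar> < e \<longrightarrow> z \<in> U"
        using U unfolding open_dist dist_real_def by blast
      with c x obtain m where "\<forall>y\<in>N x m. \<bar>f y - f x\<bar> < e" by blast
      with e x sub show "\<exists>m. N x m \<subseteq> {x \<in> P. f x \<in> U}" by blast
    qed blast
  qed auto
qed

end

section \<open>Luzin families\<close>

text \<open>One step of Luzin's recursion: \<open>X\<close> is the next member after the family
  \<open>F\<close>.\<close>

definition luzin_over :: "nat set set \<Rightarrow> nat set \<Rightarrow> bool" where
  "luzin_over F X \<longleftrightarrow> infinite X \<and> (\<forall>B\<in>F. finite (B \<inter> X)) \<and> (\<forall>n. finite {B\<in>F. B \<inter> X \<subseteq> {..<n}})"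

text \<open>Diagonalization: \<open>X\<close> takes from each \<open>b n\<close> a number outside
  all earlier members, so that it meets every member in a finite set. That number is at least
  \<open>n\<close>, so only the first \<open>n\<close> members can meet \<open>X\<close> inside
  \<open>{..<n}\<close>.\<close>

lemma luzin_over_exists:
  assumes "countable F" "infinite F" and inf: "\<And>B. B \<in> F \<Longrightarrow> infinite B"
    and ad: "\<And>B C. B \<in> F \<Longrightarrow> C \<in> F \<Longrightarrow> B \<noteq> C \<Longrightarrow> finite (B \<inter> C)"
  shows "\<exists>X. luzin_over F X"
proof -
  obtain b :: "nat \<Rightarrow> nat set" where b: "bij_betw b UNIV F"
    using assms(1,2) bij_betw_from_nat_into by blast
  then have bF: "b n \<in> F" for n by (auto simp: bij_betw_def)
  have bn: "b i \<noteq> b n" if "i \<noteq> n" for i n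
    using b that by (auto simp: bij_betw_def inj_eq)
  have "infinite (b n - ((\<Union>i<n. b i \<inter> b n) \<union> {..<n}))" for n
  proof (intro Diff_infinite_finite inf bF finite_UnI)
    show "finite (\<Union>i<n. b i \<inter> b n)"
      by (rule finite_UN_I) (auto intro: ad[OF bF bF bn])
  qed auto
  then have "\<exists>x. x \<in> b n - ((\<Union>i<n. b i \<inter> b n) \<union> {..<n})" for n
    by (metis equals0I finite.emptyI)
  then obtain a where a: "\<And>n. a n \<in> b n - ((\<Union>i<n. b i \<inter> b n) \<union> {..<n})" by metis
  then have a1: "a n \<in> b n" and a2: "i < n \<Longrightarrow> a n \<notin> b i" and a3: "n \<le> a n" for i n
    by (auto simp: not_less)
  have "infinite (range a)"
    unfolding infinite_nat_iff_unbounded_le using a3 by blast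
  moreover have "finite (b n \<inter> range a)" for n
  proof (rule finite_subset)
    show "b n \<inter> range a \<subseteq> a ` {..n}" using a2 by (auto simp: image_iff not_less) (metis atMost_iff leI)
  qed auto
  moreover have "finite {B\<in>F. B \<inter> range a \<subseteq> {..<n}}" for n
  proof (rule finite_subset)
    show "{B\<in>F. B \<inter> range a \<subseteq> {..<n}} \<subseteq> b ` {..<n}"
    proof
      fix B assume B: "B \<in> {B\<in>F. B \<inter> range a \<subseteq> {..<n}}"
      then obtain j where j: "B = b j" using b by (auto simp: bij_betw_def)
      with B a1[of j] have "a j < n" by auto
      with a3[of j] j show "B \<in> b ` {..<n}" by auto
    qed
  qed auto
  ultimately have "luzin_over F (range a)"
    unfolding luzin_over_def using b by (auto simp: bij_betw_def)
  then show ?thesis ..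
qed

definition luzin_family :: "'i rel \<Rightarrow> ('i \<Rightarrow> nat set) \<Rightarrow> bool" where
  "luzin_family r A \<longleftrightarrow> (\<forall>a\<in>Field r. infinite (A a)) \<and>
     (\<forall>a\<in>Field r. \<forall>b\<in>Field r. a \<noteq> b \<longrightarrow> finite (A a \<inter> A b)) \<and>
     (\<forall>a\<in>Field r. \<forall>n. finite {b \<in> underS r a. A b \<inter> A a \<subseteq> {..<n}})"

text \<open>The disjoint columns \<open>C k\<close> are added at every step to keep the family to be
  diagonalized infinite, also where only finitely many \<open>A b\<close> are available.\<close>

lemma luzin_family_exists:
  fixes r :: "'i rel"
  assumes r: "Well_order r" and cnt: "\<And>a. countable (underS r a)"
  shows "\<exists>A. luzin_family r A"
proof -
  define C where "C k = range (\<lambda>n. prod_encode (k, n))" for k :: nat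
  have C: "infinite (C k)" "j \<noteq> k \<Longrightarrow> C j \<inter> C k = {}" for j k
    unfolding C_def by (auto intro!: range_inj_infinite injI)
  have "inj C"
    using C by (metis finite.emptyI inf.idem injI)
  then have infC: "infinite (range C)" by (rule range_inj_infinite)
  define H where "H A a = (SOME X. luzin_over (range C \<union> A ` underS r a) X)" for A :: "'i \<Rightarrow> nat set" and a
  define A where "A = wfrec (r - Id) H"
  have wf: "wf (r - Id)" using r by (simp add: well_order_on_def)
  have Aeq: "A a = H A a" for a
  proof -
    have "A a = H (cut A (r - Id) a) a"
      unfolding A_def by (rule wfrec[OF wf])
    moreover have "cut A (r - Id) a ` underS r a = A ` underS r a"
      by (intro image_cong) (auto simp: cut_def underS_def)
    ultimately show ?thesis by (simp add: H_def)
  qed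
  have tot: "a \<in> underS r b \<or> b \<in> underS r a" if "a \<in> Field r" "b \<in> Field r" "a \<noteq> b" for a b
    using r that unfolding well_order_on_def linear_order_on_def total_on_def underS_def by blast
  have fld: "underS r a \<subseteq> Field r" for a
    by (auto simp: underS_def Field_def)
  have luz: "luzin_over (range C \<union> A ` underS r a) (A a)" for a
    using wf
  proof (induction a rule: wf_induct_rule)
    case (less a)
    have IH: "luzin_over (range C \<union> A ` underS r b) (A b)" if "b \<in> underS r a" for b
      using less that by (auto simp: underS_def)
    have ad: "finite (A b \<inter> A c)" if "b \<in> underS r a" "c \<in> underS r a" "b \<noteq> c" for b c
    proof -
      have "finite (A b \<inter> A c)" if "c \<in> underS r a" "b \<in> underS r c" for b c
        using IH[OF that(1)] that(2) unfolding luzin_over_def by blast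
      then show ?thesis using tot[of b c] fld that by (metis Int_commute subsetD)
    qed
    have "\<exists>X. luzin_over (range C \<union> A ` underS r a) X"
    proof (rule luzin_over_exists)
      show "countable (range C \<union> A ` underS r a)" using cnt by auto
      show "infinite (range C \<union> A ` underS r a)" using infC by auto
      show "infinite B" if "B \<in> range C \<union> A ` underS r a" for B
        using that C IH unfolding luzin_over_def by blast
      have CA: "finite (C k \<inter> A b)" if "b \<in> underS r a" for b k
        using IH[OF that] unfolding luzin_over_def by blast
      have CC: "finite (C k \<inter> C j)" if "C k \<noteq> C j" for j k using C(2)[of k j] that by (cases "j = k") auto
      show "finite (B \<inter> D)" if "B \<in> range C \<union> A ` underS r a" "D \<in> range C \<union> A ` underS r a" "B \<noteq> D" for B D
        using that CA CC ad by (elim UnE imageE) (metis Int_commute)+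
    qed
    then show ?case unfolding Aeq[of a] H_def by (rule someI_ex)
  qed
  have ad: "finite (A a \<inter> A b)" if "a \<in> Field r" "b \<in> Field r" "a \<noteq> b" for a b
  proof -
    have "finite (A a \<inter> A b)" if "a \<in> underS r b" for a b
      using luz[of b] that unfolding luzin_over_def by blast
    then show ?thesis using tot[OF that] by (metis Int_commute)
  qed
  have inf: "infinite (A a)" for a
    using luz unfolding luzin_over_def by blast
  \<comment> \<open>The Luzin condition so far counts sets, not indices. An infinite set is not
    almost disjoint from itself, so distinct indices carry distinct sets.\<close>
  have "inj_on A (Field r)"
    using ad inf by (intro inj_onI) (metis Int_absorb)
  moreover have "finite {B \<in> range C \<union> A ` underS r a. B \<inter> A a \<subseteq> {..<n}}" for a n
    using luz unfolding luzin_over_def by blast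
  then have "finite (A ` {b \<in> underS r a. A b \<inter> A a \<subseteq> {..<n}})" for a n
    by (rule finite_subset[rotated]) auto
  moreover have "{b \<in> underS r a. A b \<inter> A a \<subseteq> {..<n}} \<subseteq> Field r" for a n
    using fld by blast
  ultimately have "finite {b \<in> underS r a. A b \<inter> A a \<subseteq> {..<n}}" for a n
    by (meson finite_image_iff inj_on_subset)
  with ad inf show ?thesis unfolding luzin_family_def by (intro exI[of _ A]) simp
qed

text \<open>The numbers \<open>p\<close> with only countably many values below \<open>p\<close> form
  a lower set of reals, and \<rho> is its supremum. If this set is empty or everything, then
  \<open>I\<close> is countable and any \<rho> serves.\<close>

lemma countable_levels:
  fixes g :: "'i \<Rightarrow> real"
  assumes "\<And>p. countable {a\<in>I. g a < p} \<or> countable {a\<in>I. g a > p}"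
  shows "\<exists>\<rho>. countable {a\<in>I. g a \<noteq> \<rho>}"
proof -
  define S where "S = {p. countable {a\<in>I. g a < p}}"
  have down: "q \<in> S" if "p \<in> S" "q \<le> p" for p q
    using that unfolding S_def by (auto elim: countable_subset[rotated])
  consider "S = {}" | "S = UNIV" | p q where "p \<in> S" "q \<notin> S" by blast
  then show ?thesis
  proof cases
    case 1
    then have "countable {a\<in>I. g a > - real n}" for n using assms S_def by blast
    moreover have "I \<subseteq> (\<Union>n. {a\<in>I. g a > - real n})"
      by auto (metis minus_less_iff reals_Archimedean2)
    ultimately have "countable I" by (meson countable_UN countable_subset countableI_type)
    then show ?thesis by (auto intro: countable_subset)
  next
    case 2
    then have "countable {a\<in>I. g a < real n}" for n using S_def by blast
    moreover have "I \<subseteq> (\<Union>n. {a\<in>I. g a < real n})"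
      by auto (metis reals_Archimedean2)
    ultimately have "countable I" by (meson countable_UN countable_subset countableI_type)
    then show ?thesis by (auto intro: countable_subset)
  next
    case 3
    define \<rho> where "\<rho> = Sup S"
    have bdd: "bdd_above S" using down 3 by (meson bdd_above.I linorder_le_cases)
    have "\<rho> - inverse (Suc n) \<in> S" for n
    proof -
      have "\<rho> - inverse (Suc n) < Sup S" unfolding \<rho>_def by simp
      then obtain s where "s \<in> S" "\<rho> - inverse (Suc n) < s"
        using 3 by (auto elim: less_cSupE)
      then show ?thesis using down by (meson less_imp_le)
    qed
    then have 1: "countable {a\<in>I. g a < \<rho> - inverse (Suc n)}" for n by (simp add: S_def)
    have "\<rho> + inverse (Suc n) \<notin> S" for n
      using cSup_upper[OF _ bdd, of "\<rho> + inverse (Suc n)"] unfolding \<rho>_def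
      by (auto simp: field_simps)
    then have 2: "countable {a\<in>I. g a > \<rho> + inverse (Suc n)}" for n using assms S_def by blast
    have "{a\<in>I. g a \<noteq> \<rho>} \<subseteq> (\<Union>n. {a\<in>I. g a < \<rho> - inverse (Suc n)}) \<union> (\<Union>n. {a\<in>I. g a > \<rho> + inverse (Suc n)})"
    proof
      fix a assume a: "a \<in> {a\<in>I. g a \<noteq> \<rho>}"
      then obtain n where "inverse (real (Suc n)) < \<bar>g a - \<rho>\<bar>"
        using reals_Archimedean[of "\<bar>g a - \<rho>\<bar>"] by auto
      then have "g a < \<rho> - inverse (Suc n) \<or> g a > \<rho> + inverse (Suc n)" by linarith
      with a show "a \<in> (\<Union>n. {a\<in>I. g a < \<rho> - inverse (Suc n)}) \<union> (\<Union>n. {a\<in>I. g a > \<rho> + inverse (Suc n)})"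
        by blast
    qed
    moreover have "countable ((\<Union>n. {a\<in>I. g a < \<rho> - inverse (Suc n)}) \<union> (\<Union>n. {a\<in>I. g a > \<rho> + inverse (Suc n)}))"
      using 1 2 by auto
    ultimately show ?thesis by (meson countable_subset)
  qed
qed

section \<open>A rigid tree of cells\<close>

type_synonym cell = "(nat \<times> nat) list"

text \<open>The point \<open>(t, n)\<close> of the cell \<open>t\<close> is the limit of the cells \<open>t @ [(n, k)]\<close>, together with
  everything hanging on them, as \<open>k\<close> tends to infinity.\<close>

definition below :: "cell \<times> nat \<Rightarrow> nat \<Rightarrow> cell set" where
  "below q m = {s. \<exists>k>m. \<exists>u. s = fst q @ (snd q, k) # u}"

text \<open>Weighted so that a predecessor is lower by exactly one and members of
  \<open>below q m\<close> are higher than \<open>m\<close>: it is both the induction measure of the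
  graph and the way to keep a given cell out of neighbourhoods of large index.\<close>

definition height :: "cell \<Rightarrow> nat" where
  "height t = (\<Sum>p\<leftarrow>t. Suc (snd p))"

text \<open>The cells are the vertices of a graph in which every cell \<open>t \<noteq> []\<close> is joined to its predecessor:
  \<open>t @ [(n, 0)]\<close> to \<open>t\<close>, and \<open>t @ [(n, k + 1)]\<close> to \<open>t @ [(n, k)]\<close>.\<close>

definition pred_cell :: "cell \<Rightarrow> cell" where
  "pred_cell t = (if snd (last t) = 0 then butlast t else butlast t @ [(fst (last t), snd (last t) - 1)])"

lemma pred_cell_snoc:
  "pred_cell (t @ [(n, k)]) = (if k = 0 then t else t @ [(n, k - 1)])"
  by (simp add: pred_cell_def)

lemma height_pred_cell: "t \<noteq> [] \<Longrightarrow> height (pred_cell t) < height t"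
  by (cases t rule: rev_cases) (auto simp: pred_cell_snoc height_def)

lemma below_antimono: "m \<le> k \<Longrightarrow> below q k \<subseteq> below q m"
  by (auto simp: below_def)

lemma below_trans: "s \<in> below q m \<Longrightarrow> below (s, j) k \<subseteq> below q m"
  by (auto simp: below_def) 

lemma below_height: "t \<in> below q m \<Longrightarrow> m < height t"
  by (auto simp: below_def height_def)

text \<open>Two cells with a common extension are comparable.\<close>

lemma below_disjoint:
  assumes "q \<noteq> q'" "fst q \<notin> below q' k" "fst q' \<notin> below q m"
  shows "below q m \<inter> below q' k = {}"
proof (rule ccontr)
  assume "below q m \<inter> below q' k \<noteq> {}"
  then obtain a b u v where ab: "m < a" "k < b"
    and eq: "fst q @ (snd q, a) # u = fst q' @ (snd q', b) # v"
    unfolding below_def by auto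
  from eq consider us where "fst q = fst q' @ us" "us @ (snd q, a) # u = (snd q', b) # v"
    | us where "fst q' = fst q @ us" "us @ (snd q', b) # v = (snd q, a) # u"
    by (auto simp: append_eq_append_conv2)
  then show False
  proof cases
    case 1
    then show False using assms ab by (cases us) (auto simp: below_def prod_eq_iff)
  next
    case 2
    then show False using assms ab by (cases us) (auto simp: below_def prod_eq_iff)
  qed
qed

text \<open>Crossing an edge changes the entry right after \<open>fst q\<close> by at most one, and
  only in a cell that ends there; otherwise the change happens further down. An entry above
  \<open>Suc m\<close> is not 0, so the predecessor does not fall back to
  \<open>fst q\<close>.\<close>

lemma below_pred_cell:
  assumes "t \<noteq> []"
  shows "t \<in> below q (Suc m) \<Longrightarrow> pred_cell t \<in> below q m"
    and "pred_cell t \<in> below q (Suc m) \<Longrightarrow> t \<in> below q m"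
proof -
  obtain s n k where t: "t = s @ [(n, k)]" using assms by (cases t rule: rev_cases) auto
  show "pred_cell t \<in> below q m" if tb: "t \<in> below q (Suc m)"
  proof -
    obtain j u where j: "j > Suc m" "t = fst q @ (snd q, j) # u"
      using tb by (auto simp: below_def)
    show ?thesis
    proof (cases u rule: rev_cases)
      case Nil
      then have "pred_cell t = fst q @ (snd q, j - 1) # []"
        using j by (auto simp: pred_cell_snoc)
      then show ?thesis using j by (auto simp: below_def)
    next
      case (snoc u' p)
      obtain p1 p2 where "p = (p1, p2)" by force
      with snoc j have "t = (fst q @ (snd q, j) # u') @ [(p1, p2)]" by simp
      then have "pred_cell t = (if p2 = 0 then fst q @ (snd q, j) # u' else fst q @ (snd q, j) # (u' @ [(p1, p2 - 1)]))"
        by (metis pred_cell_snoc append.assoc append_Cons)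
      then show ?thesis using j by (auto simp: below_def)
    qed
  qed
  show "t \<in> below q m" if tb: "pred_cell t \<in> below q (Suc m)"
  proof -
    obtain j u where j: "j > Suc m" "pred_cell t = fst q @ (snd q, j) # u"
      using tb by (auto simp: below_def)
    show ?thesis
    proof (cases "k = 0")
      case True
      with j t have "s = fst q @ (snd q, j) # u" by (auto simp: pred_cell_snoc)
      then show ?thesis using j t by (auto simp: below_def)
    next
      case False
      with j t have eq: "s @ [(n, k - 1)] = fst q @ (snd q, j) # u" by (auto simp: pred_cell_snoc)
      show ?thesis
      proof (cases u rule: rev_cases)
        case Nil
        then show ?thesis using j t eq by (auto simp: below_def)
      next
        case (snoc u' p)
        then have "s = fst q @ (snd q, j) # u'" using eq by (metis append_Cons append_assoc butlast_snoc)
        then show ?thesis using j t by (auto simp: below_def)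
      qed
    qed
  qed
qed

text \<open>\<open>K a\<close> is the end farther from the root of the edge that carries the Luzin
  point \<open>a\<close>. A single Luzin family is distributed over all edges, uncountably many
  points to each.\<close>

locale cell_tree =
  fixes r :: "'i rel" and A :: "'i \<Rightarrow> nat set" and K :: "'i \<Rightarrow> cell"
  assumes wo: "Well_order r"
    and countable_underS: "countable (underS r a)"
    and infinite_A: "a \<in> Field r \<Longrightarrow> infinite (A a)"
    and almost_disjoint: "a \<in> Field r \<Longrightarrow> b \<in> Field r \<Longrightarrow> a \<noteq> b \<Longrightarrow> finite (A a \<inter> A b)"
    and luzin: "a \<in> Field r \<Longrightarrow> finite {b \<in> underS r a. A b \<inter> A a \<subseteq> {..<n}}"
    and K_nonempty: "a \<in> Field r \<Longrightarrow> K a \<noteq> []"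
    and K_uncountable: "t \<noteq> [] \<Longrightarrow> uncountable {a \<in> Field r. K a = t}"
begin

definition cells :: "'i \<Rightarrow> cell set" where
  "cells a = {K a, pred_cell (K a)}"

text \<open>Asking for both ends of the edge makes the spans of disjoint sets of cells
  disjoint.\<close>

definition span :: "cell set \<Rightarrow> ((cell \<times> nat) + 'i) set" where
  "span S = Inl ` (S \<times> UNIV) \<union> Inr ` {a \<in> Field r. cells a \<subseteq> S}"

definition fan :: "cell \<times> nat \<Rightarrow> nat \<Rightarrow> ((cell \<times> nat) + 'i) set" where
  "fan q m = insert (Inl q) (span (below q m))"

text \<open>The point \<open>Inr a\<close> lies on the edge between the two cells in \<open>cells a\<close> and is the limit of
  the copies of \<open>A a\<close> in both of them.\<close>

definition tree_nbhd :: "(cell \<times> nat) + 'i \<Rightarrow> nat \<Rightarrow> ((cell \<times> nat) + 'i) set" where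
  "tree_nbhd x m = (case x of Inl q \<Rightarrow> fan q m
     | Inr a \<Rightarrow> insert (Inr a) (\<Union>c\<in>cells a. \<Union>i\<in>{i \<in> A a. m \<le> i}. fan (c, i) m))"

definition tree_points :: "((cell \<times> nat) + 'i) set" where
  "tree_points = range Inl \<union> Inr ` Field r"

lemma tree_nbhd_simps [simp]:
  "tree_nbhd (Inl q) m = fan q m"
  "tree_nbhd (Inr a) m = insert (Inr a) (\<Union>c\<in>cells a. \<Union>i\<in>{i \<in> A a. m \<le> i}. fan (c, i) m)"
  by (simp_all add: tree_nbhd_def)

lemma span_simps [simp]:
  "Inl q \<in> span S \<longleftrightarrow> fst q \<in> S"
  "Inr a \<in> span S \<longleftrightarrow> a \<in> Field r \<and> cells a \<subseteq> S"
  by (auto simp: span_def image_iff mem_Times_iff)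

lemma fan_simps [simp]:
  "Inl q' \<in> fan q m \<longleftrightarrow> q' = q \<or> fst q' \<in> below q m"
  "Inr a \<in> fan q m \<longleftrightarrow> a \<in> Field r \<and> cells a \<subseteq> below q m"
  by (auto simp: fan_def)

lemma tree_points_simps [simp]: "Inl q \<in> tree_points" "Inr a \<in> tree_points \<longleftrightarrow> a \<in> Field r"
  by (auto simp: tree_points_def)

lemma span_mono: "S \<subseteq> T \<Longrightarrow> span S \<subseteq> span T"
  by (auto simp: span_def)

lemma span_disjoint: "S \<inter> T = {} \<Longrightarrow> span S \<inter> span T = {}"
  by (auto simp: span_def cells_def)

lemma fan_subset: "fan q m \<subseteq> tree_points"
  by (auto simp: fan_def tree_points_def span_def)

lemma fan_antimono: "m \<le> k \<Longrightarrow> fan q k \<subseteq> fan q m"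
  unfolding fan_def using span_mono[OF below_antimono] by blast

lemma fan_disjoint:
  assumes "q \<noteq> q'" "fst q \<notin> below q' k" "fst q' \<notin> below q m"
  shows "fan q m \<inter> fan q' k = {}"
  using span_disjoint[OF below_disjoint[OF assms]] assms by (auto simp: fan_def)

lemma fan_subset_span: "t \<in> below q m \<Longrightarrow> fan (t, j) k \<subseteq> span (below q m)"
  unfolding fan_def using span_mono[OF below_trans[of t q m j k]] by simp

lemma tree_nbhd_subset_span:
  assumes "y \<in> span (below q m)"
  shows "tree_nbhd y k \<subseteq> span (below q m)"
proof (cases y)
  case (Inl p)
  then show ?thesis using assms fan_subset_span[of "fst p" q m "snd p" k] by simp
next
  case (Inr a)
  then have "cells a \<subseteq> below q m" using assms by simp
  then have "fan (c, i) k \<subseteq> span (below q m)" if "c \<in> cells a" for c i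
    using that fan_subset_span by blast
  then show ?thesis using assms Inr by auto
qed

lemma tree_nbhd_subset_fan:
  assumes "y \<in> fan q m"
  shows "\<exists>k. tree_nbhd y k \<subseteq> fan q m"
proof (cases "y = Inl q")
  case True
  then show ?thesis by auto
next
  case False
  then have "y \<in> span (below q m)" using assms by (simp add: fan_def)
  then show ?thesis using tree_nbhd_subset_span unfolding fan_def by blast
qed

text \<open>This yields the index shift of \<open>reg\<close>: a Luzin point outside
  \<open>fan q m\<close> has neither of its cells in \<open>below q (Suc m)\<close>.\<close>

lemma cells_below:
  assumes "a \<in> Field r" "c \<in> cells a" "c \<in> below q (Suc m)"
  shows "cells a \<subseteq> below q m"
  using assms below_pred_cell[OF K_nonempty[OF assms(1)], of q m] below_antimono[of m "Suc m" q]
  unfolding cells_def by auto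

lemma cells_nonempty_finite: "cells a \<noteq> {}" "finite (cells a)"
  by (auto simp: cells_def)

definition max_height :: "'i \<Rightarrow> nat" where "max_height a = Max (height ` cells a)"

lemma height_le_max_height: "c \<in> cells a \<Longrightarrow> height c \<le> max_height a"
  by (simp add: max_height_def cells_nonempty_finite)

lemma not_below_max_height: "c \<in> cells a \<Longrightarrow> max_height a \<le> k \<Longrightarrow> c \<notin> below q k"
  using below_height height_le_max_height by (meson leD le_trans)

text \<open>Fans with different centres are disjoint once neither centre's cell lies below the other
  centre. Heights keep the cells of \<open>x\<close> out of the fans around \<open>y\<close>, and
  the index shift keeps the cells of \<open>y\<close> out of those around \<open>x\<close>.\<close>

lemma tree_nbhd_reg:
  assumes x: "x \<in> tree_points" and y: "y \<in> tree_points" and yx: "y \<notin> tree_nbhd x m"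
  shows "\<exists>k. tree_nbhd y k \<inter> tree_nbhd x (Suc m) = {}"
proof (cases x)
  case x: (Inl q)
  show ?thesis
  proof (cases y)
    case y: (Inl p)
    have "p \<noteq> q" "fst p \<notin> below q m" using yx x y by auto
    then have "fst p \<notin> below q (Suc m)" using below_antimono[of m "Suc m" q] by auto
    with \<open>p \<noteq> q\<close> have "fan p (height (fst q)) \<inter> fan q (Suc m) = {}"
      by (intro fan_disjoint) (auto dest: below_height)
    then show ?thesis using x y by auto
  next
    case (Inr a)
    then have a: "a \<in> Field r" "\<not> cells a \<subseteq> below q m" using y yx x by auto
    then have nb: "c \<notin> below q (Suc m)" if "c \<in> cells a" for c
      using cells_below that by blast
    \<comment> \<open>The first bound makes the centres \<open>(c, i)\<close> different from
      \<open>q\<close>, the second keeps the cell of \<open>q\<close> out of their fans.\<close>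
    define k where "k = max (Suc (snd q)) (height (fst q))"
    have "fan (c, i) k \<inter> fan q (Suc m) = {}" if "c \<in> cells a" "k \<le> i" for c i
    proof (rule fan_disjoint)
      show "(c, i) \<noteq> q" using that by (auto simp: k_def)
      show "fst (c, i) \<notin> below q (Suc m)" using nb that by simp
      show "fst q \<notin> below (c, i) k" by (auto dest!: below_height simp: k_def)
    qed
    moreover have "Inr a \<notin> fan q (Suc m)"
      using nb cells_nonempty_finite(1)[of a] by auto
    ultimately have "tree_nbhd y k \<inter> tree_nbhd x (Suc m) = {}"
      unfolding Inr x by (auto simp del: fan_simps)
    then show ?thesis ..
  qed
next
  case xa: (Inr a)
  then have a: "a \<in> Field r" using x by simp
  show ?thesis
  proof (cases y)
    case (Inl q)
    have *: "q \<noteq> (c, i)" "fst q \<notin> below (c, i) m" if "c \<in> cells a" "i \<in> A a" "m \<le> i" for c i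
      using yx that unfolding xa Inl by auto
    have "fan q (max_height a) \<inter> fan (c, i) (Suc m) = {}" if "c \<in> cells a" "i \<in> A a" "Suc m \<le> i" for c i
    proof (rule fan_disjoint)
      show "q \<noteq> (c, i)" using * that by simp
      show "fst q \<notin> below (c, i) (Suc m)"
        using *(2)[of c i] that below_antimono[of m "Suc m" "(c, i)"] by auto
      show "fst (c, i) \<notin> below q (max_height a)"
        using that not_below_max_height by simp
    qed
    moreover have "Inr a \<notin> fan q (max_height a)"
      using not_below_max_height cells_nonempty_finite(1) by (metis fan_simps(2) all_not_in_conv order_refl subsetD)
    ultimately have "tree_nbhd y (max_height a) \<inter> tree_nbhd x (Suc m) = {}"
      unfolding Inl xa by (auto simp del: fan_simps)
    then show ?thesis ..
  next
    case (Inr b)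
    then have b: "b \<in> Field r" "b \<noteq> a" using y yx xa by auto
    then have "finite (A a \<inter> A b)" using almost_disjoint a by auto
    then obtain l where l: "\<And>i. i \<in> A a \<Longrightarrow> i \<in> A b \<Longrightarrow> i < l"
      by (metis IntI finite_nat_iff_bounded lessThan_iff subsetD)
    \<comment> \<open>Beyond \<open>l\<close> the sets \<open>A a\<close> and \<open>A b\<close>
      have no common element; this separates the centres when the two edges share a cell.\<close>
    define k where "k = max l (max_height a)"
    have nb: "c' \<notin> below (c, i) (Suc m)" if "c \<in> cells a" "i \<in> A a" "m \<le> i" "c' \<in> cells b" for c c' i
      using cells_below[OF b(1) that(4), of "(c, i)" m] yx that b unfolding xa Inr by auto
    have "fan (c', j) k \<inter> fan (c, i) (Suc m) = {}"
      if "c \<in> cells a" "i \<in> A a" "Suc m \<le> i" "c' \<in> cells b" "j \<in> A b" "k \<le> j" for c c' i j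
    proof (rule fan_disjoint)
      show "(c', j) \<noteq> (c, i)" using l[of i] that by (auto simp: k_def)
      show "fst (c', j) \<notin> below (c, i) (Suc m)" using nb that by simp
      show "fst (c, i) \<notin> below (c', j) k"
        using that not_below_max_height[of c a k] by (simp add: k_def)
    qed
    moreover have "Inr a \<notin> fan (c', j) k" for c' j
      using not_below_max_height[of _ a k] cells_nonempty_finite(1)[of a] by (auto simp: k_def)
    moreover have "Inr b \<notin> fan (c, i) (Suc m)" if "c \<in> cells a" "i \<in> A a" "Suc m \<le> i" for c i
      using nb[of c i] that cells_nonempty_finite(1)[of b] by auto
    ultimately have "tree_nbhd y k \<inter> tree_nbhd x (Suc m) = {}"
      unfolding Inr xa tree_nbhd_simps using b(2) by (intro equals0I) (elim IntE insertE UN_E; blast)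
    then show ?thesis ..
  qed
qed

lemma tree_nbhd_sep:
  assumes x: "x \<in> tree_points" and y: "y \<in> tree_points" and xy: "x \<noteq> y"
  shows "\<exists>m. y \<notin> tree_nbhd x m"
proof (cases y)
  case y: (Inl q)
  show ?thesis
  proof (cases x)
    case (Inl p)
    then have "y \<notin> tree_nbhd x (height (fst q))" using y xy by (auto dest: below_height)
    then show ?thesis ..
  next
    case (Inr a)
    then have "y \<notin> tree_nbhd x (max (Suc (snd q)) (height (fst q)))"
      using y by (auto dest: below_height)
    then show ?thesis ..
  qed
next
  case b: (Inr b)
  have "y \<notin> fan q (max_height b)" for q
    using not_below_max_height[OF _ order_refl, of _ b q] cells_nonempty_finite(1)[of b] b by auto
  then have "y \<notin> tree_nbhd x (max_height b)" using xy by (cases x) (auto simp del: fan_simps)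
  then show ?thesis ..
qed

lemma nbhd_system_tree: "nbhd_system tree_points tree_nbhd"
proof
  show "tree_nbhd x m \<subseteq> tree_points" if "x \<in> tree_points" for x m
    using that fan_subset by (cases x) (auto simp del: fan_simps)
  show "x \<in> tree_nbhd x m" if "x \<in> tree_points" for x m
    by (cases x) auto
  show "tree_nbhd x (Suc m) \<subseteq> tree_nbhd x m" for x m
  proof (cases x)
    case (Inl q)
    then show ?thesis using fan_antimono[of m "Suc m" q] by simp
  next
    case (Inr a)
    have "fan (c, i) (Suc m) \<subseteq> fan (c, i) m" for c i using fan_antimono[of m "Suc m"] by simp
    then show ?thesis using Inr by (fastforce simp del: fan_simps)
  qed
  show "\<exists>k. tree_nbhd y k \<subseteq> tree_nbhd x m" if y: "x \<in> tree_points" "y \<in> tree_nbhd x m" for x y m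
  proof (cases x)
    case (Inl q)
    then show ?thesis using tree_nbhd_subset_fan y by simp
  next
    case (Inr a)
    then consider "y = x" | c i where "c \<in> cells a" "i \<in> A a" "m \<le> i" "y \<in> fan (c, i) m"
      using y by (auto simp del: fan_simps)
    then show ?thesis
    proof cases
      case 2
      then obtain k where "tree_nbhd y k \<subseteq> fan (c, i) m" using tree_nbhd_subset_fan by blast
      moreover have "fan (c, i) m \<subseteq> tree_nbhd x m" using 2 Inr by auto
      ultimately show ?thesis by blast
    qed auto
  qed
qed (use tree_nbhd_reg tree_nbhd_sep in auto)

end

section \<open>Continuous real functions on the tree\<close>

context cell_tree begin

context
  fixes f :: "(cell \<times> nat) + 'i \<Rightarrow> real"
  assumes f: "\<And>x e. x \<in> tree_points \<Longrightarrow> e > 0 \<Longrightarrow> \<exists>m. \<forall>y\<in>tree_nbhd x m. \<bar>f y - f x\<bar> < e"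
begin

lemma near_Inr:
  assumes a: "a \<in> Field r" "t \<in> cells a" and e: "e > 0"
  shows "\<exists>m. \<forall>i\<in>A a. m \<le> i \<longrightarrow> \<bar>f (Inl (t, i)) - f (Inr a)\<bar> < e"
proof -
  have "Inr a \<in> tree_points" using a by simp
  from f[OF this e] obtain m where m: "\<forall>y\<in>tree_nbhd (Inr a) m. \<bar>f y - f (Inr a)\<bar> < e" ..
  have "Inl (t, i) \<in> tree_nbhd (Inr a) m" if "i \<in> A a" "m \<le> i" for i
    using that a(2) by auto
  with m show ?thesis by blast
qed

text \<open>Both uncountable sets would contain uncountable subsets on which the almost disjoint sets
  can be cut at the same number, which the Luzin property forbids.\<close>

lemma countable_below_or_above:
  "countable {a \<in> {a \<in> Field r. t \<in> cells a}. f (Inr a) < p} \<or>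
   countable {a \<in> {a \<in> Field r. t \<in> cells a}. f (Inr a) > p}"
proof (rule ccontr)
  define I where "I = {a \<in> Field r. t \<in> cells a}"
  assume *: "\<not> ?thesis"
  have lo: "\<exists>m. \<forall>i\<in>A a. m \<le> i \<longrightarrow> f (Inl (t, i)) < p" if "a \<in> I" "f (Inr a) < p" for a
  proof -
    from that near_Inr[of a t "p - f (Inr a)"] obtain m
      where m: "\<forall>i\<in>A a. m \<le> i \<longrightarrow> \<bar>f (Inl (t, i)) - f (Inr a)\<bar> < p - f (Inr a)" by (auto simp: I_def)
    have "f (Inl (t, i)) < p" if "i \<in> A a" "m \<le> i" for i using m that by fastforce
    then show ?thesis by blast
  qed
  have hi: "\<exists>m. \<forall>i\<in>A a. m \<le> i \<longrightarrow> f (Inl (t, i)) > p" if "a \<in> I" "f (Inr a) > p" for a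
  proof -
    from that near_Inr[of a t "f (Inr a) - p"] obtain m
      where m: "\<forall>i\<in>A a. m \<le> i \<longrightarrow> \<bar>f (Inl (t, i)) - f (Inr a)\<bar> < f (Inr a) - p" by (auto simp: I_def)
    have "f (Inl (t, i)) > p" if "i \<in> A a" "m \<le> i" for i using m that by fastforce
    then show ?thesis by blast
  qed
  define L where "L m = {a \<in> I. \<forall>i\<in>A a. m \<le> i \<longrightarrow> f (Inl (t, i)) < p}" for m
  define H where "H m = {a \<in> I. \<forall>i\<in>A a. m \<le> i \<longrightarrow> f (Inl (t, i)) > p}" for m
  have "{a \<in> I. f (Inr a) < p} \<subseteq> (\<Union>m. L m)" "{a \<in> I. f (Inr a) > p} \<subseteq> (\<Union>m. H m)"
    using lo hi by (auto simp: L_def H_def)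
  then obtain l h where lh: "uncountable (L l)" "uncountable (H h)"
    using * countable_subset countable_UN[OF countableI_type] unfolding I_def by (metis (no_types, lifting))
  have LI: "L l \<subseteq> Field r" and HI: "H h \<subseteq> Field r" by (auto simp: L_def H_def I_def)
  \<comment> \<open>Initial segments being countable, the countable set \<open>D\<close> cannot be
    cofinal in the uncountable \<open>H h\<close>: some \<open>b\<close> there lies above all of
    \<open>D\<close>, which gives \<open>b\<close> infinitely many predecessors meeting
    \<open>A b\<close> below \<open>max l h\<close>.\<close>
  obtain D where D: "D \<subseteq> L l" "countable D" "infinite D"
    using infinite_countable_subset'[of "L l"] uncountable_infinite[OF lh(1)] by auto
  have "countable (\<Union>d\<in>D. insert d (underS r d))"
    using D(2) countable_underS by auto
  then have "\<not> H h \<subseteq> (\<Union>d\<in>D. insert d (underS r d))"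
    using lh(2) countable_subset by blast
  then obtain b where b: "b \<in> H h" "\<And>d. d \<in> D \<Longrightarrow> b \<noteq> d \<and> b \<notin> underS r d" by blast
  have "d \<in> underS r b" if "d \<in> D" for d
  proof -
    have "b \<in> Field r" "d \<in> Field r" "b \<noteq> d" using that b D LI HI by auto
    then have "(b, d) \<in> r \<or> (d, b) \<in> r"
      using wo by (simp add: well_order_on_def linear_order_on_def total_on_def)
    then show ?thesis using b(2)[OF that] by (auto simp: underS_def)
  qed
  moreover have "A d \<inter> A b \<subseteq> {..<max l h}" if "d \<in> D" for d
  proof
    fix i assume i: "i \<in> A d \<inter> A b"
    show "i \<in> {..<max l h}"
    proof (rule ccontr)
      assume "i \<notin> {..<max l h}"
      then have "f (Inl (t, i)) < p" "f (Inl (t, i)) > p"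
        using i that D(1) b(1) by (auto simp: L_def H_def)
      then show False by simp
    qed
  qed
  ultimately have "D \<subseteq> {d \<in> underS r b. A d \<inter> A b \<subseteq> {..<max l h}}" by blast
  with luzin[of b "max l h"] b(1) HI D(3) show False
    by (meson finite_subset subsetD)
qed

text \<open>Adjacent cells share uncountably many Luzin points, so their generic values agree;
  descending along predecessors leads to the root.\<close>

lemma cell_value: "\<exists>\<rho>. \<forall>t. countable {a \<in> Field r. t \<in> cells a \<and> f (Inr a) \<noteq> \<rho>}"
proof -
  have "\<exists>\<rho>. countable {a \<in> {a \<in> Field r. t \<in> cells a}. f (Inr a) \<noteq> \<rho>}" for t
    using countable_below_or_above by (rule countable_levels)
  then have "\<exists>\<rho>. countable {a \<in> Field r. t \<in> cells a \<and> f (Inr a) \<noteq> \<rho>}" for t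
    by (simp add: conj_assoc)
  then have "\<forall>t. \<exists>\<rho>. countable {a \<in> Field r. t \<in> cells a \<and> f (Inr a) \<noteq> \<rho>}" by blast
  from choice[OF this] obtain \<rho> where
    \<rho>: "\<And>t. countable {a \<in> Field r. t \<in> cells a \<and> f (Inr a) \<noteq> \<rho> t}" by blast
  have step: "\<rho> t = \<rho> (pred_cell t)" if "t \<noteq> []" for t
  proof (rule ccontr)
    assume ne: "\<rho> t \<noteq> \<rho> (pred_cell t)"
    have "{a \<in> Field r. K a = t} \<subseteq> {a \<in> Field r. t \<in> cells a \<and> f (Inr a) \<noteq> \<rho> t} \<union>
        {a \<in> Field r. pred_cell t \<in> cells a \<and> f (Inr a) \<noteq> \<rho> (pred_cell t)}"
      using ne by (auto simp: cells_def)
    then show False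
      using K_uncountable[OF that] \<rho>[of t] \<rho>[of "pred_cell t"] by (meson countable_Un countable_subset)
  qed
  have "\<rho> t = \<rho> []" for t
  proof (induction "height t" arbitrary: t rule: less_induct)
    case less
    then show ?case using step height_pred_cell by (cases "t = []") metis+
  qed
  note const = this
  have "\<forall>t. countable {a \<in> Field r. t \<in> cells a \<and> f (Inr a) \<noteq> \<rho> []}"
  proof
    fix t
    show "countable {a \<in> Field r. t \<in> cells a \<and> f (Inr a) \<noteq> \<rho> []}"
      using \<rho>[of t] unfolding const[of t] .
  qed
  then show ?thesis ..
qed

text \<open>The exceptional Luzin points come last: a cell point is a limit of unexceptional Luzin
  points on edges below it, and then every Luzin point is a limit of cell points.\<close>

lemma continuous_imp_constant: "\<exists>\<rho>. \<forall>x\<in>tree_points. f x = \<rho>"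
proof -
  obtain \<rho> where \<rho>: "\<And>t. countable {a \<in> Field r. t \<in> cells a \<and> f (Inr a) \<noteq> \<rho>}"
    using cell_value by blast
  have lim: "f x = \<rho>" if "x \<in> tree_points" and y: "\<And>m. \<exists>y\<in>tree_nbhd x m. f y = \<rho>" for x
  proof (rule ccontr)
    assume "f x \<noteq> \<rho>"
    then have "\<bar>f x - \<rho>\<bar> > 0" by simp
    from f[OF that(1) this] obtain m where "\<forall>y\<in>tree_nbhd x m. \<bar>f y - f x\<bar> < \<bar>f x - \<rho>\<bar>" ..
    with y[of m] show False by (metis abs_minus_commute less_irrefl)
  qed
  have q: "f (Inl q) = \<rho>" for q
  proof (rule lim)
    fix m
    \<comment> \<open>Two more than \<open>m\<close>: one for the strict inequality in
      \<open>below\<close>, one for the edge crossed in \<open>cells_below\<close>.\<close>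
    define t where "t = fst q @ [(snd q, Suc (Suc m))]"
    have "t \<noteq> []" by (simp add: t_def)
    have "\<not> {a \<in> Field r. K a = t} \<subseteq> {a \<in> Field r. t \<in> cells a \<and> f (Inr a) \<noteq> \<rho>}"
      using K_uncountable[OF \<open>t \<noteq> []\<close>] \<rho>[of t] countable_subset by blast
    then obtain a where a: "a \<in> Field r" "K a = t" "f (Inr a) = \<rho>"
      by (auto simp: cells_def)
    have "t \<in> below q (Suc m)" unfolding t_def below_def by blast
    then have "cells a \<subseteq> below q m" using cells_below[of a t] a by (auto simp: cells_def)
    with a show "\<exists>y\<in>tree_nbhd (Inl q) m. f y = \<rho>" by (intro bexI[of _ "Inr a"]) auto
  qed simp
  have "f (Inr a) = \<rho>" if a: "a \<in> Field r" for a
  proof (rule lim)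
    fix m
    obtain i where "i \<in> A a" "m \<le> i" using infinite_A[OF a] infinite_nat_iff_unbounded_le by blast
    then have "Inl (K a, i) \<in> tree_nbhd (Inr a) m" by (auto simp: cells_def)
    with q show "\<exists>y\<in>tree_nbhd (Inr a) m. f y = \<rho>" by blast
  qed (use a in simp)
  with q show ?thesis by (auto simp: tree_points_def)
qed

end

lemma tree_nbhd_dense: 
  assumes "x \<in> tree_points"
  shows "tree_nbhd x m \<inter> range Inl \<noteq> {}"
proof (cases x)
  case (Inr a)
  then have a: "a \<in> Field r" using assms by simp
  obtain i where "i \<in> A a" "m \<le> i" using infinite_A[OF a] infinite_nat_iff_unbounded_le by blast
  then have "Inl (K a, i) \<in> tree_nbhd (Inr a) m" by (auto simp: cells_def)
  then show ?thesis using Inr by blast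
qed (auto simp: fan_def)

end

text \<open>Stated through neighbourhoods because it will be applied to a restriction from a larger
  system, of which it is enough to know that its neighbourhoods contain the given ones.\<close>

definition rigid_nbhds :: "'a set \<Rightarrow> ('a \<Rightarrow> nat \<Rightarrow> 'a set) \<Rightarrow> bool" where
  "rigid_nbhds P N \<longleftrightarrow>
     (\<forall>f::'a \<Rightarrow> real. (\<forall>x\<in>P. \<forall>e>0. \<exists>m. \<forall>y\<in>N x m. \<bar>f y - f x\<bar> < e) \<longrightarrow> (\<exists>c. \<forall>x\<in>P. f x = c))"

section \<open>The rigid space with at most \<open>omega1\<close> points\<close>

lemma omega1_props: "Card_order omega1" "infinite (Field omega1)" "uncountable (Field omega1)"
  "countable (underS omega1 a)"
proof -
  show c: "Card_order omega1"
    unfolding omega1_def by (simp add: cardSuc_Card_order natLeq_Card_order)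
  have "natLeq <o omega1"
    unfolding omega1_def by (simp add: cardSuc_greater natLeq_Card_order)
  then have n: "|UNIV :: nat set| <o |Field omega1|"
    using c card_of_Field_ordIso card_of_nat ordIso_ordLess_trans ordIso_symmetric ordLess_ordIso_trans by metis
  then show u: "uncountable (Field omega1)"
    using countable_card_le_natLeq card_of_nat not_ordLess_ordLeq ordIso_symmetric ordLeq_ordIso_trans by metis
  then show "infinite (Field omega1)" using countable_finite by blast
  show "countable (underS omega1 a)"
  proof (cases "a \<in> Field omega1")
    case True
    then have "|underS omega1 a| <o omega1" by (rule card_of_underS[OF c])
    then have "|underS omega1 a| \<le>o natLeq"
      unfolding omega1_def by (rule iffD1[OF cardSuc_ordLeq_ordLess[OF natLeq_Card_order card_of_Card_order]])
    then show ?thesis by (simp add: countable_card_le_natLeq)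
  next
    case False
    then have "underS omega1 a = {}" by (auto simp: underS_def Field_def)
    then show ?thesis by simp
  qed
qed

lemma rigid_nbhd_system_exists:
  "\<exists>(P :: ((cell \<times> nat) + nat set) set) N Q. nbhd_system P N \<and> rigid_nbhds P N \<and>
     |P| \<le>o omega1 \<and> countable Q \<and> Q \<subseteq> P \<and> (\<forall>x\<in>P. \<forall>m. N x m \<inter> Q \<noteq> {}) \<and>
     (\<exists>x\<in>P. \<exists>y\<in>P. x \<noteq> y)"
proof -
  have wo: "Well_order omega1" using omega1_props(1) by (simp add: card_order_on_def)
  obtain A where A: "luzin_family omega1 A"
    using luzin_family_exists[OF wo omega1_props(4)] by blast
  have cntle: "|X| \<le>o |Field omega1|" if "countable X" for X :: "'z set"
  proof -
    have "|X| \<le>o natLeq" using that by (simp add: countable_card_le_natLeq)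
    moreover have "natLeq \<le>o |Field omega1|" using omega1_props(2) infinite_iff_natLeq_ordLeq by blast
    ultimately show ?thesis using ordLeq_transitive by blast
  qed
  \<comment> \<open>The second coordinate of a bijection onto this product assigns
    \<open>omega1\<close> many indices to each of the countably many edges.\<close>
  have "|Field omega1 \<times> {t :: cell. t \<noteq> []}| =o |Field omega1|"
    using card_of_Times_infinite[OF omega1_props(2) _ cntle, of "{t :: cell. t \<noteq> []}"] by auto
  then obtain h where h: "bij_betw h (Field omega1) (Field omega1 \<times> {t :: cell. t \<noteq> []})"
    using card_of_ordIso ordIso_symmetric by blast
  define K where "K = snd \<circ> h"
  interpret cell_tree omega1 A K
  proof
    show "K a \<noteq> []" if "a \<in> Field omega1" for a
    proof -
      have "h a \<in> Field omega1 \<times> {t :: cell. t \<noteq> []}"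
        using h that unfolding bij_betw_def by (metis imageI)
      then show ?thesis by (simp add: K_def mem_Times_iff)
    qed
    fix t :: cell assume t: "t \<noteq> []"
    show "uncountable {a \<in> Field omega1. K a = t}"
    proof
      assume c: "countable {a \<in> Field omega1. K a = t}"
      have "Field omega1 \<subseteq> (fst \<circ> h) ` {a \<in> Field omega1. K a = t}"
      proof
        fix b assume "b \<in> Field omega1"
        then have "(b, t) \<in> h ` Field omega1" using h t by (simp add: bij_betw_def)
        then obtain a where "a \<in> Field omega1" "h a = (b, t)" by force
        then show "b \<in> (fst \<circ> h) ` {a \<in> Field omega1. K a = t}"
          by (intro image_eqI[of _ _ a]) (auto simp: K_def)
      qed
      then show False using c omega1_props(3) by (meson countable_image countable_subset)
    qed
  next
    show "infinite (A a)" if "a \<in> Field omega1" for a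
      using A that by (simp add: luzin_family_def)
    show "finite (A a \<inter> A b)" if "a \<in> Field omega1" "b \<in> Field omega1" "a \<noteq> b" for a b
      using A that by (simp add: luzin_family_def)
    show "finite {b \<in> underS omega1 a. A b \<inter> A a \<subseteq> {..<n}}" if "a \<in> Field omega1" for a n
      using A that by (simp add: luzin_family_def)
  qed (rule wo, rule omega1_props(4))
  have "rigid_nbhds tree_points tree_nbhd"
    unfolding rigid_nbhds_def using continuous_imp_constant by blast
  moreover have "|tree_points| \<le>o omega1"
  proof -
    have "|range Inl :: ((cell \<times> nat) + nat set) set| \<le>o |Field omega1|" by (rule cntle) auto
    moreover have "|Inr ` Field omega1 :: ((cell \<times> nat) + nat set) set| \<le>o |Field omega1|" by (rule card_of_image)
    moreover have "Card_order |Field omega1|" "infinite (Field |Field omega1| )"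
      using omega1_props(2) by (simp_all add: card_of_card_order_on Field_card_of)
    ultimately have "|tree_points| \<le>o |Field omega1|"
      unfolding tree_points_def by (intro card_of_Un_ordLeq_infinite_Field)
    then show ?thesis using card_of_Field_ordIso omega1_props(1) ordLeq_ordIso_trans by blast
  qed
  moreover have "countable (range Inl :: ((cell \<times> nat) + nat set) set)" by auto
  moreover have "range Inl \<subseteq> tree_points" by (auto simp: tree_points_def)
  moreover have "Inl ([], 0) \<in> tree_points" "Inl ([], Suc 0) \<in> tree_points" "Inl ([], 0) \<noteq> Inl ([], Suc 0)" by auto
  ultimately show ?thesis using nbhd_system_tree tree_nbhd_dense by metis
qed

section \<open>Adding one limit point\<close>

definition small_bounded :: "bool" where
  "small_bounded \<longleftrightarrow> (\<forall>F :: (nat \<Rightarrow> nat) set. |F| <o continuum \<longrightarrow> (\<exists>g. \<forall>f\<in>F. \<forall>\<^sub>\<infinity>n. f n \<le> g n))"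

definition small_unsplit :: "bool" where
  "small_unsplit \<longleftrightarrow> (\<forall>F :: nat set set. |F| <o continuum \<longrightarrow>
     (\<exists>A. infinite A \<and> (\<forall>S\<in>F. finite (A \<inter> S) \<or> finite (A - S))))"

lemma small_bounded_if_b_eq_c:
  assumes "bounding_number =o splitting_number" "splitting_number =o continuum"
  shows small_bounded
  unfolding small_bounded_def
proof (intro allI impI)
  fix F :: "(nat \<Rightarrow> nat) set" assume F: "|F| <o continuum"
  have "continuum =o bounding_number" using assms ordIso_transitive ordIso_symmetric by blast
  then have "|F| <o bounding_number" using F ordLess_ordIso_trans by blast
  then have "\<not> bounding_number \<le>o |F|" using not_ordLess_ordLeq by blast
  then have "\<not> unbounded_family F"
    using least_card(2)[where P = unbounded_family, OF unbounded_family_UNIV] unfolding bounding_number_def by blast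
  then show "\<exists>g. \<forall>f\<in>F. \<forall>\<^sub>\<infinity>n. f n \<le> g n" unfolding unbounded_family_def by blast
qed

lemma small_unsplit_if_s_eq_c:
  assumes "splitting_number =o continuum"
  shows small_unsplit
  unfolding small_unsplit_def
proof (intro allI impI)
  fix F :: "nat set set" assume F: "|F| <o continuum"
  define F' where "F' = {S \<in> F. infinite S}"
  have "|F'| \<le>o |F|" unfolding F'_def by (rule card_of_mono1) auto
  then have "|F'| <o splitting_number"
    using F assms ordLeq_ordLess_trans ordLess_ordIso_trans ordIso_symmetric by blast
  then have "\<not> splitting_number \<le>o |F'|" using not_ordLess_ordLeq by blast
  then have "\<not> splitting_family F'"
    using least_card(2)[where P = splitting_family, OF splitting_family_infinite] unfolding splitting_number_def by blast
  then obtain A where A: "infinite A" "\<And>S. S \<in> F' \<Longrightarrow> \<not> (infinite (A \<inter> S) \<and> infinite (A - S))"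
    unfolding splitting_family_def F'_def by blast
  have "finite (A \<inter> S) \<or> finite (A - S)" if "S \<in> F" for S
    using A(2)[of S] that unfolding F'_def by (cases "finite S") auto
  with A(1) show "\<exists>A. infinite A \<and> (\<forall>S\<in>F. finite (A \<inter> S) \<or> finite (A - S))" by blast
qed

text \<open>The new point \<open>z\<close> has the neighbourhoods \<open>insert z (L m)\<close> and is put into the old
  neighbourhoods \<open>N x m\<close> with \<open>(x, m) \<in> C\<close>.\<close>

definition ext_nbhds ::
  "('a \<Rightarrow> nat \<Rightarrow> 'a set) \<Rightarrow> 'a \<Rightarrow> (nat \<Rightarrow> 'a set) \<Rightarrow> ('a \<times> nat) set \<Rightarrow> 'a \<Rightarrow> nat \<Rightarrow> 'a set" where
  "ext_nbhds N z L C x m =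
     (if x = z then insert z (L m) else if (x, m) \<in> C then insert z (N x m) else N x m)"

text \<open>The last two clauses carry the recursion: the neighbourhoods receiving the new point are
  closed under passing to larger ones and contain no disjoint pair, so old inclusions and
  disjointnesses remain true.\<close>

definition good_ext ::
  "'a set \<Rightarrow> ('a \<Rightarrow> nat \<Rightarrow> 'a set) \<Rightarrow> 'a \<Rightarrow> (nat \<Rightarrow> 'a) \<Rightarrow> (nat \<Rightarrow> 'a set) \<Rightarrow> ('a \<times> nat) set \<Rightarrow> bool" where
  "good_ext P N z s L C \<longleftrightarrow>
     (\<forall>m. L m \<subseteq> P) \<and> C \<subseteq> P \<times> UNIV \<and>
     nbhd_system (insert z P) (ext_nbhds N z L C) \<and>
     (\<forall>m. infinite {n. s n \<in> L m}) \<and>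
     (\<forall>x\<in>P. \<forall>y\<in>P. \<forall>k m. N y k \<subseteq> N x m \<longrightarrow> (y, k) \<in> C \<longrightarrow> (x, m) \<in> C) \<and>
     (\<forall>x\<in>P. \<forall>y\<in>P. \<forall>k m. N y k \<inter> N x m = {} \<longrightarrow> (y, k) \<in> C \<longrightarrow> (x, m) \<notin> C)"

lemma infinite_continuum: "\<not> finite (Field continuum)" "Card_order continuum"
  unfolding continuum_def by (simp_all add: Field_card_of card_of_card_order_on infinite_UNIV_char_0)

lemma countable_small:
  assumes "countable X"
  shows "|X| <o continuum"
proof -
  have "|X| \<le>o |UNIV :: nat set|"
    using assms unfolding countable_def card_of_ordLeq[symmetric] by blast
  moreover have "|UNIV :: nat set| <o |UNIV :: real set|"
    using uncountable_UNIV_real by (auto simp: card_of_ordLess[symmetric] countable_def)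
  ultimately show ?thesis
    unfolding continuum_def by (rule ordLeq_ordLess_trans)
qed

lemma card_image_Times_nat:
  assumes "|P| <o continuum"
  shows "|f ` (P \<times> (UNIV :: nat set))| <o continuum"
proof -
  have "|P \<times> (UNIV :: nat set)| <o continuum"
  proof (cases "finite P")
    case True
    then show ?thesis by (intro countable_small) (simp add: countable_finite)
  next
    case False
    then have "|P \<times> (UNIV :: nat set)| =o |P|"
      using card_of_Times_infinite[of P "UNIV :: nat set"] infinite_iff_card_of_nat by blast
    then show ?thesis using assms ordIso_ordLess_trans by blast
  qed
  then show ?thesis using card_of_image ordLeq_ordLess_trans by blast
qed

context nbhd_system
begin

text \<open>Each \<open>N x m\<close> contains almost all or almost none of the terms
  \<open>s n\<close> with \<open>n \<in> A\<close>; \<open>C\<close> collects the first kind. From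
  index \<open>fi x m n\<close> on, neighbourhoods of a term inside \<open>N x m\<close> stay
  inside, and from \<open>fo x m n\<close> on those of a term outside avoid
  \<open>N x (Suc m)\<close>. These are fewer than \<cc> functions of \<open>n\<close>, all
  eventually dominated by \<open>g\<close>.\<close>

lemma good_ext_exists:
  assumes small: "|P| <o continuum" and bd: small_bounded and us: small_unsplit
    and z: "z \<notin> P" and s: "inj s" "range s \<subseteq> P"
    and noacc: "\<And>y. y \<in> P \<Longrightarrow> \<exists>m. finite {n. s n \<in> N y m}"
  shows "\<exists>L C. good_ext P N z s L C"
proof -
  have sP: "s n \<in> P" for n using s by auto
  obtain A where A: "infinite A"
    and split: "\<And>x m. x \<in> P \<Longrightarrow> finite (A \<inter> {n. s n \<in> N x m}) \<or> finite (A - {n. s n \<in> N x m})"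
  proof -
    have "|(\<lambda>(x, m). {n. s n \<in> N x m}) ` (P \<times> UNIV)| <o continuum"
      using small by (rule card_image_Times_nat)
    then obtain A where A: "infinite A"
      "\<forall>S\<in>(\<lambda>(x, m). {n. s n \<in> N x m}) ` (P \<times> UNIV). finite (A \<inter> S) \<or> finite (A - S)"
      using us unfolding small_unsplit_def by blast
    have "finite (A \<inter> {n. s n \<in> N x m}) \<or> finite (A - {n. s n \<in> N x m})" if "x \<in> P" for x m
    proof -
      have "{n. s n \<in> N x m} \<in> (\<lambda>(x, m). {n. s n \<in> N x m}) ` (P \<times> UNIV)"
        using that by (intro image_eqI[of _ _ "(x, m)"]) auto
      then show ?thesis by (rule bspec[OF A(2)])
    qed
    then show ?thesis using A(1) that by blast
  qed
  \<comment> \<open>If no such \<open>k\<close> exists, the value is arbitrary; it is used only for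
    \<open>s n\<close> inside \<open>N x m\<close> for \<open>fi\<close>, and outside for
    \<open>fo\<close>.\<close>
  define fi where "fi x m n = (LEAST k. N (s n) k \<subseteq> N x m)" for x m n
  define fo where "fo x m n = (LEAST k. N (s n) k \<inter> N x (Suc m) = {})" for x m n
  obtain g where gi: "\<And>x m. x \<in> P \<Longrightarrow> \<forall>\<^sub>\<infinity>n. fi x m n \<le> g n"
    and go: "\<And>x m. x \<in> P \<Longrightarrow> \<forall>\<^sub>\<infinity>n. fo x m n \<le> g n"
  proof -
    define F where "F = (\<lambda>(x, m) n. max (fi x m n) (fo x m n)) ` (P \<times> UNIV)"
    have "|F| <o continuum"
      unfolding F_def using small by (rule card_image_Times_nat)
    then obtain g where g: "\<And>f. f \<in> F \<Longrightarrow> \<forall>\<^sub>\<infinity>n. f n \<le> g n"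
      using bd unfolding small_bounded_def by blast
    have "\<forall>\<^sub>\<infinity>n. max (fi x m n) (fo x m n) \<le> g n" if "x \<in> P" for x m
    proof (rule g)
      show "(\<lambda>n. max (fi x m n) (fo x m n)) \<in> F"
        unfolding F_def using that by (intro image_eqI[of _ _ "(x, m)"]) auto
    qed
    then show ?thesis by (intro that[of g]) (simp_all add: eventually_conj_iff)
  qed
  have fi: "N (s n) (fi x m n) \<subseteq> N x m" if "x \<in> P" "s n \<in> N x m" for x m n
    unfolding fi_def using op[OF that] by (rule LeastI_ex)
  have fo: "N (s n) (fo x m n) \<inter> N x (Suc m) = {}" if "x \<in> P" "s n \<notin> N x m" for x m n
    unfolding fo_def using reg[OF that(1) sP that(2)] by (rule LeastI_ex)
  \<comment> \<open>The index \<open>m\<close> plays two parts: it cuts off the first terms, where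
    \<open>g\<close> may fail to dominate, and it shrinks the remaining neighbourhoods, so that
    \<open>reg\<close> at the terms gives \<open>reg\<close> at the new point.\<close>
  define L where "L m = (\<Union>n\<in>{n \<in> A. m \<le> n}. N (s n) (g n + m))" for m
  define C where "C = {(x, m). x \<in> P \<and> finite {n \<in> A. s n \<notin> N x m}}"
  have C_iff: "(x, m) \<in> C \<longleftrightarrow> finite {n \<in> A. s n \<notin> N x m}" if "x \<in> P" for x m
    using that by (simp add: C_def)
  have notC: "finite {n \<in> A. s n \<in> N x m}" if "x \<in> P" "(x, m) \<notin> C" for x m
  proof -
    have "A \<inter> {n. s n \<in> N x m} = {n \<in> A. s n \<in> N x m}" "A - {n. s n \<in> N x m} = {n \<in> A. s n \<notin> N x m}" by auto
    then show ?thesis using split[OF that(1), of m] that C_iff by simp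
  qed
  have inC: "\<exists>n\<in>A. s n \<in> N x m \<and> s n \<in> N y k" if "(x, m) \<in> C" "(y, k) \<in> C" for x m y k
  proof -
    have "finite ({n \<in> A. s n \<notin> N x m} \<union> {n \<in> A. s n \<notin> N y k})" using that by (simp add: C_def)
    then have "\<not> A \<subseteq> {n \<in> A. s n \<notin> N x m} \<union> {n \<in> A. s n \<notin> N y k}"
      using A finite_subset by blast
    then show ?thesis by blast
  qed
  have C_mono: "(x, m) \<in> C" if "x \<in> P" "N y k \<subseteq> N x m" "(y, k) \<in> C" for x y k m
  proof -
    have "{n \<in> A. s n \<notin> N x m} \<subseteq> {n \<in> A. s n \<notin> N y k}" using that by blast
    then show ?thesis using that finite_subset by (auto simp: C_def)
  qed
  have C_disj: "(x, m) \<notin> C" if "N y k \<inter> N x m = {}" "(y, k) \<in> C" for x y k m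
    using inC[OF that(2)] that(1) by blast
  have LP: "L m \<subseteq> P" for m unfolding L_def using sub sP by blast
  have Ldec: "L (Suc m) \<subseteq> L m" for m
  proof -
    have "N (s n) (g n + Suc m) \<subseteq> N (s n) (g n + m)" for n using dec sP by simp
    then show ?thesis unfolding L_def by fastforce
  qed
  have sL: "s n \<in> L m" if "n \<in> A" "m \<le> n" for n m
    unfolding L_def using that self sP by blast
  have Linf: "infinite {n. s n \<in> L m}" for m
  proof -
    have "infinite (A - {..<m})" using A by (simp add: Diff_infinite_finite)
    moreover have "A - {..<m} \<subseteq> {n. s n \<in> L m}" using sL by auto
    ultimately show ?thesis using finite_subset by blast
  qed
  have Lin: "\<exists>k. L k \<subseteq> N x m" if "(x, m) \<in> C" for x m
  proof -
    have x: "x \<in> P" using that by (simp add: C_def)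
    have "finite {n \<in> A. s n \<notin> N x m}" using that by (simp add: C_def)
    then obtain a where a: "\<And>n. n \<in> A \<Longrightarrow> s n \<notin> N x m \<Longrightarrow> n < a"
      unfolding finite_nat_iff_bounded by blast
    obtain b where b: "\<And>n. b \<le> n \<Longrightarrow> fi x m n \<le> g n"
      using gi[OF x, of m] unfolding MOST_nat_le by blast
    have "N (s n) (g n + max a b) \<subseteq> N x m" if "n \<in> A" "max a b \<le> n" for n
    proof -
      have "s n \<in> N x m" using a that by force
      then have "N (s n) (fi x m n) \<subseteq> N x m" using fi x by blast
      moreover have "N (s n) (g n + max a b) \<subseteq> N (s n) (fi x m n)"
        using b[of n] that by (intro antimono sP) auto
      ultimately show ?thesis by blast
    qed
    then show ?thesis unfolding L_def by blast
  qed
  have Lout: "\<exists>k. \<forall>n\<in>A. k \<le> n \<longrightarrow> N (s n) (g n) \<inter> N x (Suc m) = {}"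
    if x: "x \<in> P" "(x, m) \<notin> C" for x m
  proof -
    obtain a where a: "\<And>n. n \<in> A \<Longrightarrow> s n \<in> N x m \<Longrightarrow> n < a"
      using notC[OF x] unfolding finite_nat_iff_bounded by blast
    obtain b where b: "\<And>n. b \<le> n \<Longrightarrow> fo x m n \<le> g n"
      using go[OF x(1), of m] unfolding MOST_nat_le by blast
    have "N (s n) (g n) \<inter> N x (Suc m) = {}" if "n \<in> A" "max a b \<le> n" for n
    proof -
      have "s n \<notin> N x m" using a that by force
      then have "N (s n) (fo x m n) \<inter> N x (Suc m) = {}" using fo x by blast
      moreover have "N (s n) (g n) \<subseteq> N (s n) (fo x m n)"
        using b[of n] that by (intro antimono sP) auto
      ultimately show ?thesis by blast
    qed
    then show ?thesis by blast
  qed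
  have Lout': "\<exists>k. L k \<inter> N x (Suc m) = {}" if x: "x \<in> P" "(x, m) \<notin> C" for x m
  proof -
    obtain k where k: "\<And>n. n \<in> A \<Longrightarrow> k \<le> n \<Longrightarrow> N (s n) (g n) \<inter> N x (Suc m) = {}"
      using Lout[OF x] by blast
    have "N (s n) (g n + k) \<subseteq> N (s n) (g n)" for n by (intro antimono sP) auto
    then have "L k \<inter> N x (Suc m) = {}" unfolding L_def using k by blast
    then show ?thesis ..
  qed
  \<comment> \<open>Here the absence of accumulation points enters: no old point has the new point
    in all its neighbourhoods.\<close>
  have escape: "\<exists>m. (y, m) \<notin> C" if y: "y \<in> P" for y
  proof -
    obtain m where "finite {n. s n \<in> N y m}" using noacc[OF y] by blast
    then have "infinite (A - {n. s n \<in> N y m})" using A by simp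
    moreover have "A - {n. s n \<in> N y m} = {n \<in> A. s n \<notin> N y m}" by auto
    ultimately show ?thesis using y by (auto simp: C_def)
  qed
  have Lreg: "\<exists>k. N y k \<inter> L (Suc m) = {} \<and> (y, k) \<notin> C" if y: "y \<in> P" "y \<notin> L m" for y m
  proof -
    obtain j where j: "(y, j) \<notin> C" using escape[OF y(1)] by blast
    obtain b where b: "\<And>n. n \<in> A \<Longrightarrow> b \<le> n \<Longrightarrow> N (s n) (g n) \<inter> N y (Suc j) = {}"
      using Lout[OF y(1) j] by blast
    have "\<exists>k. N y k \<inter> N (s n) (g n + Suc m) = {}" if "n \<in> A" "m \<le> n" for n
      using reg[OF sP y(1), of n "g n + m"] y(2) that unfolding L_def by auto
    then obtain h where h: "\<And>n. n \<in> A \<Longrightarrow> m \<le> n \<Longrightarrow> N y (h n) \<inter> N (s n) (g n + Suc m) = {}" by metis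
    \<comment> \<open>From \<open>b\<close> on one neighbourhood of \<open>y\<close> avoids all the
      sets; the finitely many earlier terms are handled one by one.\<close>
    define k where "k = Max (insert (Suc j) (h ` {..<b}))"
    have kj: "Suc j \<le> k" and kh: "n < b \<Longrightarrow> h n \<le> k" for n by (auto simp: k_def)
    have "N y k \<inter> N (s n) (g n + Suc m) = {}" if n: "n \<in> A" "Suc m \<le> n" for n
    proof (cases "n < b")
      case True
      then have "N y k \<subseteq> N y (h n)" using kh y by (intro antimono) auto
      with h[of n] n show ?thesis by auto
    next
      case False
      then have "N (s n) (g n) \<inter> N y (Suc j) = {}" using b n by auto
      moreover have "N y k \<subseteq> N y (Suc j)" using kj y by (intro antimono) auto
      moreover have "N (s n) (g n + Suc m) \<subseteq> N (s n) (g n)" by (intro antimono sP) auto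
      ultimately show ?thesis by blast
    qed
    then have "N y k \<inter> L (Suc m) = {}" unfolding L_def by blast
    moreover have "(y, k) \<notin> C" using C_mono[OF y(1), of y k j] j kj antimono[OF y(1), of j k] by auto
    ultimately show ?thesis by blast
  qed
  have znot: "z \<notin> N x m" if "x \<in> P" for x m using sub[OF that] z by blast
  let ?N = "ext_nbhds N z L C"
  have Nz: "?N z m = insert z (L m)" for m by (simp add: ext_nbhds_def)
  have Nx: "?N x m = N x m \<union> {w. w = z \<and> (x, m) \<in> C}" if "x \<in> P" for x m
    using that z by (auto simp: ext_nbhds_def)
  have Nmono: "?N y k \<subseteq> ?N x m" if "x \<in> P" "y \<in> P" "N y k \<subseteq> N x m" for x y k m
    using that C_mono[OF that(1,3)] by (auto simp: Nx)
  have Ndisj: "?N y k \<inter> ?N x m = {}" if "x \<in> P" "y \<in> P" "N y k \<inter> N x m = {}" for x y k m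
    using that C_disj[OF that(3)] znot by (auto simp: Nx)
  have "nbhd_system (insert z P) ?N"
  proof
    show "?N x m \<subseteq> insert z P" if "x \<in> insert z P" for x m
      using that LP[of m] sub[of x m] by (cases "x = z") (auto simp: Nz Nx)
    show "x \<in> ?N x m" if "x \<in> insert z P" for x m
      using that self by (cases "x = z") (auto simp: Nz Nx)
    show "?N x (Suc m) \<subseteq> ?N x m" if "x \<in> insert z P" for x m
    proof (cases "x = z")
      case True
      then show ?thesis using Ldec by (auto simp: Nz)
    next
      case False
      then show ?thesis using that dec by (intro Nmono) auto
    qed
    show "\<exists>k. ?N y k \<subseteq> ?N x m" if x: "x \<in> insert z P" and y: "y \<in> ?N x m" for x y m
    proof (cases "x = z")
      case True
      show ?thesis
      proof (cases "y = z")
        case False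
        then obtain n where n: "n \<in> A" "m \<le> n" "y \<in> N (s n) (g n + m)"
          using y True by (auto simp: Nz L_def)
        then obtain k where "N y k \<subseteq> N (s n) (g n + m)" using op sP by blast
        moreover have "y \<in> P" using n sub sP by blast
        ultimately have "?N y k \<subseteq> insert z (L m)"
          using n by (auto simp: Nx L_def)
        then show ?thesis using True by (auto simp: Nz)
      qed (use True in auto)
    next
      case False
      then have x: "x \<in> P" using x by simp
      show ?thesis
      proof (cases "y = z")
        case True
        then have "(x, m) \<in> C" using y x znot by (auto simp: Nx)
        with Lin obtain k where "L k \<subseteq> N x m" by blast
        then have "?N y k \<subseteq> ?N x m" using True \<open>(x, m) \<in> C\<close> x by (auto simp: Nz Nx)
        then show ?thesis ..
      next
        case False
        then have "y \<in> N x m" using y x by (simp add: Nx)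
        moreover then have "y \<in> P" using sub x by blast
        ultimately show ?thesis using op[OF x] Nmono[OF x] by blast
      qed
    qed
    show "\<exists>k. ?N y k \<inter> ?N x (Suc m) = {}"
      if x: "x \<in> insert z P" and y: "y \<in> insert z P" and yx: "y \<notin> ?N x m" for x y m
    proof (cases "x = z")
      case True
      then have y: "y \<in> P" "y \<notin> L m" using y yx by (auto simp: Nz)
      from Lreg[OF this] obtain k where "N y k \<inter> L (Suc m) = {}" "(y, k) \<notin> C" by blast
      then have "?N y k \<inter> ?N x (Suc m) = {}" using True y znot by (auto simp: Nz Nx)
      then show ?thesis ..
    next
      case False
      then have x: "x \<in> P" using x by simp
      show ?thesis
      proof (cases "y = z")
        case True
        then have nC: "(x, m) \<notin> C" using yx x by (simp add: Nx)
        then have "(x, Suc m) \<notin> C" using C_mono[OF x dec[OF x]] by blast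
        moreover obtain k where "L k \<inter> N x (Suc m) = {}" using Lout'[OF x nC] by blast
        ultimately have "?N y k \<inter> ?N x (Suc m) = {}" using True x znot by (auto simp: Nz Nx)
        then show ?thesis ..
      next
        case False
        then have "y \<in> P" "y \<notin> N x m" using y yx x by (auto simp: Nx)
        then obtain k where "N y k \<inter> N x (Suc m) = {}" using reg[OF x] by blast
        then have "?N y k \<inter> ?N x (Suc m) = {}" by (rule Ndisj[OF x \<open>y \<in> P\<close>])
        then show ?thesis ..
      qed
    qed
    show "\<exists>m. y \<notin> ?N x m" if x: "x \<in> insert z P" and y: "y \<in> insert z P" and xy: "x \<noteq> y" for x y
    proof (cases "x = z")
      case True
      then have y: "y \<in> P" using y xy by simp
      obtain j where "(y, j) \<notin> C" using escape[OF y] by blast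
      from Lout'[OF y this] obtain k where "L k \<inter> N y (Suc j) = {}" by blast
      then have "y \<notin> L k" using self[OF y] by blast
      then have "y \<notin> ?N x k" using True xy by (simp add: Nz)
      then show ?thesis ..
    next
      case False
      then have x: "x \<in> P" using x by simp
      show ?thesis
      proof (cases "y = z")
        case True
        then show ?thesis using escape[OF x] x znot by (auto simp: Nx)
      next
        case False
        then show ?thesis using sep[OF x _ xy] y x by (auto simp: Nx)
      qed
    qed
  qed
  moreover have "C \<subseteq> P \<times> UNIV" by (auto simp: C_def)
  ultimately have "good_ext P N z s L C"
    unfolding good_ext_def using LP Linf C_mono C_disj by blast
  then show ?thesis by blast
qed

end

section \<open>The recursion\<close>

abbreviation before :: "real \<Rightarrow> real set" where
  "before \<equiv> underS continuum"

lemma continuum_order: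
  shows continuum_wf: "wf (continuum - Id)"
    and before_irrefl: "\<alpha> \<notin> before \<alpha>"
    and before_trans: "\<gamma> \<in> before \<beta> \<Longrightarrow> \<beta> \<in> before \<alpha> \<Longrightarrow> \<gamma> \<in> before \<alpha>"
    and before_total: "\<alpha> = \<beta> \<or> \<alpha> \<in> before \<beta> \<or> \<beta> \<in> before \<alpha>"
    and before_small: "|before \<alpha>| <o continuum"
proof -
  have wo: "Well_order continuum" and F: "Field continuum = UNIV"
    using card_of_Well_order by (auto simp: continuum_def Field_card_of)
  show "wf (continuum - Id)" using wo by (simp add: well_order_on_def)
  show "\<alpha> \<notin> before \<alpha>" by (simp add: underS_def)
  show "\<alpha> = \<beta> \<or> \<alpha> \<in> before \<beta> \<or> \<beta> \<in> before \<alpha>"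
    using wo unfolding well_order_on_def linear_order_on_def total_on_def underS_def F by blast
  show "\<gamma> \<in> before \<alpha>" if "\<gamma> \<in> before \<beta>" "\<beta> \<in> before \<alpha>"
    using wo that unfolding well_order_on_def linear_order_on_def partial_order_on_def
      preorder_on_def underS_def trans_def antisym_def by blast
  show "|before \<alpha>| <o continuum"
    using infinite_continuum(2) F by (intro card_of_underS) auto
qed

lemma insert_before_small: "|insert \<alpha> (before \<alpha>)| <o continuum"
proof -
  have "|{\<alpha>}| <o continuum" by (rule countable_small) simp
  then have "|{\<alpha>} \<union> before \<alpha>| <o continuum"
    by (rule card_of_Un_ordLess_infinite_Field[OF infinite_continuum _ before_small])
  then show ?thesis by simp
qed

lemma before_induct [case_names less]:
  assumes "\<And>\<alpha>. (\<And>\<beta>. \<beta> \<in> before \<alpha> \<Longrightarrow> Q \<beta>) \<Longrightarrow> Q \<alpha>"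
  shows "Q \<alpha>"
  using continuum_wf
proof (induction \<alpha> rule: wf_induct_rule)
  case (less \<alpha>)
  show ?case
  proof (rule assms)
    fix \<beta> assume "\<beta> \<in> before \<alpha>"
    then show "Q \<beta>" by (intro less) (simp add: underS_def)
  qed
qed

text \<open>Otherwise \<omega>-sequences of naturals, enumerated by the reals, would be covered by
  countably many families smaller than \<cc>. Bounding each family, and then the countably many
  bounds, would bound all functions at once.\<close>

lemma small_bounded_cofinality:
  assumes bd: small_bounded and Z: "countable Z"
  shows "\<exists>\<alpha>. Z \<subseteq> before \<alpha>"
proof (rule ccontr)
  assume no: "\<not> ?thesis"
  have cover: "\<exists>\<zeta>\<in>Z. \<alpha> \<in> insert \<zeta> (before \<zeta>)" for \<alpha>
    using no before_total[of \<alpha>] by blast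
  have "|UNIV :: (nat \<Rightarrow> nat) set| \<le>o |UNIV :: real set|"
  proof -
    have "inj (\<lambda>f :: nat \<Rightarrow> nat. range (\<lambda>n. prod_encode (n, f n)))"
    proof (intro injI ext)
      fix f g :: "nat \<Rightarrow> nat" and n
      assume eq: "range (\<lambda>n. prod_encode (n, f n)) = range (\<lambda>n. prod_encode (n, g n))"
      have "prod_encode (n, f n) \<in> range (\<lambda>n. prod_encode (n, g n))" unfolding eq[symmetric] by simp
      then show "f n = g n" by auto
    qed
    moreover obtain j :: "nat set \<Rightarrow> real" where "inj j"
      using nat_sets_eqpoll_reals by (auto simp: eqpoll_def bij_betw_def)
    ultimately have "inj (\<lambda>f :: nat \<Rightarrow> nat. j (range (\<lambda>n. prod_encode (n, f n))))"
      by (simp add: inj_def)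
    then show ?thesis by (subst card_of_ordLeq[symmetric]) auto
  qed
  then obtain e :: "real \<Rightarrow> nat \<Rightarrow> nat" where e: "range e = UNIV"
    using card_of_ordLeq2[of "UNIV :: (nat \<Rightarrow> nat) set" "UNIV :: real set"] by auto
  have "\<exists>g. \<forall>f\<in>e ` insert \<zeta> (before \<zeta>). \<forall>\<^sub>\<infinity>n. f n \<le> g n" for \<zeta>
  proof -
    have "|e ` insert \<zeta> (before \<zeta>)| <o continuum"
      using insert_before_small[of \<zeta>] card_of_image ordLeq_ordLess_trans by blast
    then show ?thesis using bd unfolding small_bounded_def by blast
  qed
  then obtain G where G: "\<And>\<zeta> f. f \<in> e ` insert \<zeta> (before \<zeta>) \<Longrightarrow> \<forall>\<^sub>\<infinity>n. f n \<le> G \<zeta> n" by metis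
  have "|G ` Z| <o continuum" using Z by (intro countable_small) simp
  then obtain g where g: "\<And>\<zeta>. \<zeta> \<in> Z \<Longrightarrow> \<forall>\<^sub>\<infinity>n. G \<zeta> n \<le> g n"
    using bd unfolding small_bounded_def by blast
  obtain \<alpha> where \<alpha>: "e \<alpha> = (\<lambda>n. Suc (g n))" using e by (metis surjD)
  obtain \<zeta> where \<zeta>: "\<zeta> \<in> Z" "\<alpha> \<in> insert \<zeta> (before \<zeta>)" using cover by blast
  then have "\<forall>\<^sub>\<infinity>n. Suc (g n) \<le> G \<zeta> n" using G[OF imageI[OF \<zeta>(2), of e]] by (simp add: \<alpha>)
  with g[OF \<zeta>(1)] have "\<forall>\<^sub>\<infinity>n::nat. False"
    by eventually_elim simp
  then show False by simp
qed

text \<open>There are at most \<cc> sequences, so reals can be matched with pairs of a real and a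
  sequence. Each sequence then owns \<cc> many stages, more than an initial segment can
  hold.\<close>

lemma bookkeeping:
  fixes e :: "'p \<Rightarrow> nat set"
  assumes "inj e"
  shows "\<exists>\<phi> :: real \<Rightarrow> nat \<Rightarrow> 'p. \<forall>s \<alpha>. \<exists>\<beta>. \<alpha> \<in> before \<beta> \<and> \<phi> \<beta> = s"
proof -
  have "inj (\<lambda>s. {prod_encode (n, k) | n k. k \<in> e (s n)})"
  proof (rule injI)
    fix s t assume eq: "{prod_encode (n, k) | n k. k \<in> e (s n)} = {prod_encode (n, k) | n k. k \<in> e (t n)}"
    have "k \<in> e (s n) \<longleftrightarrow> k \<in> e (t n)" for n k
      using eq[THEN eqset_imp_iff, of "prod_encode (n, k)"] by simp
    then show "s = t" using assms by (auto simp: inj_def set_eq_iff fun_eq_iff)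
  qed
  moreover obtain j :: "nat set \<Rightarrow> real" where "inj j"
    using nat_sets_eqpoll_reals by (auto simp: eqpoll_def bij_betw_def)
  ultimately have "inj (\<lambda>s. j {prod_encode (n, k) | n k. k \<in> e (s n)})"
    by (simp add: inj_def)
  then have "|UNIV :: (nat \<Rightarrow> 'p) set| \<le>o |UNIV :: real set|"
    by (subst card_of_ordLeq[symmetric]) auto
  then have "|(UNIV :: real set) \<times> (UNIV :: (nat \<Rightarrow> 'p) set)| =o |UNIV :: real set|"
    using card_of_Times_infinite[of "UNIV :: real set"] infinite_UNIV_char_0 by blast
  then obtain h :: "real \<Rightarrow> real \<times> (nat \<Rightarrow> 'p)" where h: "bij h"
    using card_of_ordIso ordIso_symmetric by (metis UNIV_Times_UNIV)
  have "\<exists>\<beta>. \<alpha> \<in> before \<beta> \<and> snd (h \<beta>) = s" for s \<alpha>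
  proof (rule ccontr)
    assume no: "\<not> ?thesis"
    have "inv h (x, s) \<in> insert \<alpha> (before \<alpha>)" for x
    proof -
      have "h (inv h (x, s)) = (x, s)" using h by (simp add: bij_def surj_f_inv_f)
      then show ?thesis using no before_total[of \<alpha> "inv h (x, s)"] by force
    qed
    moreover have "inj (\<lambda>x. inv h (x, s))"
      using h by (intro injI) (metis bij_inv_eq_iff prod.inject)
    ultimately have "|UNIV :: real set| \<le>o |insert \<alpha> (before \<alpha>)|"
      by (subst card_of_ordLeq[symmetric]) blast
    then have "continuum \<le>o |insert \<alpha> (before \<alpha>)|" by (simp add: continuum_def)
    moreover have "|insert \<alpha> (before \<alpha>)| <o continuum" by (rule insert_before_small)
    ultimately show False using not_ordLess_ordLeq by blast
  qed
  then show ?thesis by (intro exI[of _ "\<lambda>\<beta>. snd (h \<beta>)"]) blast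
qed

text \<open>Whether a point is added, its neighbourhoods \<open>L\<close>, and the set
  \<open>C\<close> of old neighbourhoods receiving it.\<close>

type_synonym 'a stage = "bool \<times> (nat \<Rightarrow> ('a + real) set) \<times> (('a + real) \<times> nat) set"

section \<open>The tower of extensions over a small space\<close>

locale tower = base: nbhd_system P0 N0 for P0 :: "'a set" and N0 +
  fixes \<phi> :: "real \<Rightarrow> nat \<Rightarrow> 'a + real"
  assumes P0_small: "|P0| <o continuum"
    and bounded: small_bounded
    and unsplit: small_unsplit
begin

definition act :: "(real \<Rightarrow> 'a stage) \<Rightarrow> real set" where
  "act h = {\<gamma>. fst (h \<gamma>)}"

definition base_nbhd :: "(real \<Rightarrow> 'a stage) \<Rightarrow> 'a + real \<Rightarrow> nat \<Rightarrow> ('a + real) set" where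
  "base_nbhd h x m = (case x of Inl a \<Rightarrow> Inl ` N0 a m | Inr \<beta> \<Rightarrow> insert (Inr \<beta>) (fst (snd (h \<beta>)) m))"

definition points :: "(real \<Rightarrow> 'a stage) \<Rightarrow> real set \<Rightarrow> ('a + real) set" where
  "points h I = Inl ` P0 \<union> Inr ` (I \<inter> act h)"

text \<open>All stages are read off one history, so limit stages need no construction. The empty
  value outside the points of the stage makes the result depend only on \<open>h\<close> restricted
  to \<open>I\<close>, as the recursion requires.\<close>

definition nbhds :: "(real \<Rightarrow> 'a stage) \<Rightarrow> real set \<Rightarrow> 'a + real \<Rightarrow> nat \<Rightarrow> ('a + real) set" where
  "nbhds h I x m = (if x \<in> points h I
     then base_nbhd h x m \<union> Inr ` {\<gamma> \<in> I \<inter> act h. (x, m) \<in> snd (snd (h \<gamma>))} else {})"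

text \<open>A stage is active if the sequence attached to it by the bookkeeping still has to be given an
  accumulation point.\<close>

definition valid :: "('a + real) set \<Rightarrow> ('a + real \<Rightarrow> nat \<Rightarrow> ('a + real) set) \<Rightarrow> real \<Rightarrow> 'a stage \<Rightarrow> bool" where
  "valid P N \<alpha> v \<longleftrightarrow>
     (fst v \<longleftrightarrow> inj (\<phi> \<alpha>) \<and> range (\<phi> \<alpha>) \<subseteq> P \<and> (\<forall>y\<in>P. \<exists>m. finite {n. \<phi> \<alpha> n \<in> N y m})) \<and>
     (fst v \<longrightarrow> good_ext P N (Inr \<alpha>) (\<phi> \<alpha>) (fst (snd v)) (snd (snd v)))"

definition next_stage :: "(real \<Rightarrow> 'a stage) \<Rightarrow> real \<Rightarrow> 'a stage" where
  "next_stage h \<alpha> = (SOME v. valid (points h (before \<alpha>)) (nbhds h (before \<alpha>)) \<alpha> v)"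

definition hist :: "real \<Rightarrow> 'a stage" where
  "hist = wfrec (continuum - Id) next_stage"

abbreviation "active \<equiv> act hist"
abbreviation "L \<gamma> \<equiv> fst (snd (hist \<gamma>))"
abbreviation "C \<gamma> \<equiv> snd (snd (hist \<gamma>))"
abbreviation "P \<equiv> points hist"
abbreviation "N \<equiv> nbhds hist"

lemma points_nbhds_cong:
  assumes "\<And>\<gamma>. \<gamma> \<in> I \<Longrightarrow> h \<gamma> = h' \<gamma>"
  shows "points h I = points h' I" "nbhds h I = nbhds h' I"
proof -
  have act: "I \<inter> act h = I \<inter> act h'" using assms by (auto simp: act_def)
  then show p: "points h I = points h' I" by (simp add: points_def)
  have "{\<gamma> \<in> I \<inter> act h. (x, m) \<in> snd (snd (h \<gamma>))} = {\<gamma> \<in> I \<inter> act h'. (x, m) \<in> snd (snd (h' \<gamma>))}" for x m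
    using act assms by auto
  moreover have "base_nbhd h x m = base_nbhd h' x m" if "x \<in> points h I" for x m
    using that assms by (auto simp: base_nbhd_def points_def)
  ultimately show "nbhds h I = nbhds h' I"
    unfolding nbhds_def p[symmetric] by (intro ext) simp
qed

lemma hist_eq: "hist \<alpha> = next_stage hist \<alpha>"
proof -
  have "hist \<alpha> = next_stage (cut hist (continuum - Id) \<alpha>) \<alpha>"
    unfolding hist_def by (rule wfrec[OF continuum_wf])
  also have "\<dots> = next_stage hist \<alpha>"
  proof -
    have "cut hist (continuum - Id) \<alpha> \<gamma> = hist \<gamma>" if "\<gamma> \<in> before \<alpha>" for \<gamma>
      using that by (simp add: cut_def underS_def)
    from points_nbhds_cong[OF this, of "before \<alpha>" "\<lambda>x. x"] show ?thesis
      unfolding next_stage_def by simp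
  qed
  finally show ?thesis .
qed

definition good :: "real \<Rightarrow> bool" where
  "good \<gamma> \<longleftrightarrow> valid (P (before \<gamma>)) (N (before \<gamma>)) \<gamma> (hist \<gamma>)"

definition initial :: "real set \<Rightarrow> bool" where
  "initial I \<longleftrightarrow> (\<forall>\<alpha>\<in>I. before \<alpha> \<subseteq> I)"

lemma initial_before: "initial (before \<alpha>)" "initial (insert \<alpha> (before \<alpha>))"
  using before_trans by (auto simp: initial_def)

lemma points_simps [simp]:
  "Inl a \<in> P I \<longleftrightarrow> a \<in> P0" "Inr \<gamma> \<in> P I \<longleftrightarrow> \<gamma> \<in> I \<and> \<gamma> \<in> active"
  by (auto simp: points_def)

lemma points_mono: "J \<subseteq> I \<Longrightarrow> P J \<subseteq> P I"
  by (auto simp: points_def)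

lemma nbhds_extend:
  assumes "J \<subseteq> I" "x \<in> P J"
  shows "N I x m = N J x m \<union> Inr ` {\<gamma> \<in> (I - J) \<inter> active. (x, m) \<in> C \<gamma>}"
  using assms points_mono[OF assms(1)] by (auto simp: nbhds_def)

lemma good_extD:
  assumes "good \<gamma>" "\<gamma> \<in> active"
  shows "good_ext (P (before \<gamma>)) (N (before \<gamma>)) (Inr \<gamma>) (\<phi> \<gamma>) (L \<gamma>) (C \<gamma>)"
  using assms by (simp add: good_def valid_def act_def)

lemma C_sub:
  assumes "good \<gamma>" "\<gamma> \<in> active" "(x, m) \<in> C \<gamma>"
  shows "x \<in> P (before \<gamma>)"
  using good_extD[OF assms(1,2)] assms(3) by (auto simp: good_ext_def)

text \<open>What is read off the history agrees with the one-point extension, because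
  \<open>C \<delta>\<close> mentions only points from before \<delta>: no stage up to \<gamma> adds
  anything to the neighbourhoods of the point \<gamma>.\<close>

lemma succ_stage:
  assumes "good \<gamma>" "\<gamma> \<in> active" and below: "\<And>\<delta>. \<delta> \<in> before \<gamma> \<Longrightarrow> good \<delta>"
  shows "nbhd_system (P (insert \<gamma> (before \<gamma>))) (N (insert \<gamma> (before \<gamma>)))"
proof -
  have ge: "nbhd_system (insert (Inr \<gamma>) (P (before \<gamma>))) (ext_nbhds (N (before \<gamma>)) (Inr \<gamma>) (L \<gamma>) (C \<gamma>))"
    "C \<gamma> \<subseteq> P (before \<gamma>) \<times> UNIV"
    using good_extD[OF assms(1,2)] by (simp_all add: good_ext_def)
  have P: "P (insert \<gamma> (before \<gamma>)) = insert (Inr \<gamma>) (P (before \<gamma>))"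
    using assms(2) by (auto simp: points_def)
  have "N (insert \<gamma> (before \<gamma>)) x m = ext_nbhds (N (before \<gamma>)) (Inr \<gamma>) (L \<gamma>) (C \<gamma>) x m" for x m
  proof -
    consider "x = Inr \<gamma>" | "x \<in> P (before \<gamma>)" "x \<noteq> Inr \<gamma>" | "x \<notin> P (insert \<gamma> (before \<gamma>))" "x \<noteq> Inr \<gamma>"
      using P by blast
    then show ?thesis
    proof cases
      case 1
      have "(Inr \<gamma>, m) \<notin> C \<delta>" if d: "\<delta> \<in> insert \<gamma> (before \<gamma>)" "\<delta> \<in> active" for \<delta>
      proof
        assume "(Inr \<gamma>, m) \<in> C \<delta>"
        then have "Inr \<gamma> \<in> P (before \<delta>)" using d assms(1) below by (intro C_sub) auto
        then have "\<gamma> \<in> before \<delta>" by simp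
        then show False using d before_irrefl before_trans by blast
      qed
      then have e: "{\<delta> \<in> insert \<gamma> (before \<gamma>) \<inter> active. (Inr \<gamma>, m) \<in> C \<delta>} = {}" by blast
      show ?thesis unfolding nbhds_def 1 e using assms(2)
        by (simp add: base_nbhd_def ext_nbhds_def)
    next
      case 2
      then have "N (insert \<gamma> (before \<gamma>)) x m =
          N (before \<gamma>) x m \<union> Inr ` {\<delta> \<in> (insert \<gamma> (before \<gamma>) - before \<gamma>) \<inter> active. (x, m) \<in> C \<delta>}"
        by (intro nbhds_extend) auto
      also have "{\<delta> \<in> (insert \<gamma> (before \<gamma>) - before \<gamma>) \<inter> active. (x, m) \<in> C \<delta>} = {\<delta>. \<delta> = \<gamma> \<and> (x, m) \<in> C \<gamma>}"
        using assms(2) before_irrefl by auto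
      finally show ?thesis using 2 by (auto simp: ext_nbhds_def)
    next
      case 3
      then have "x \<notin> P (before \<gamma>)" using P by blast
      then show ?thesis using 3 ge(2) by (auto simp: nbhds_def ext_nbhds_def)
    qed
  qed
  then have "N (insert \<gamma> (before \<gamma>)) = ext_nbhds (N (before \<gamma>)) (Inr \<gamma>) (L \<gamma>) (C \<gamma>)" by (intro ext)
  with ge P show ?thesis by simp
qed

lemma base_stage: "nbhd_system (P {}) (N {})"
proof -
  have P: "P {} = Inl ` P0" by (simp add: points_def)
  have N: "N {} (Inl a) m = Inl ` N0 a m" if "a \<in> P0" for a m
    using that by (simp add: nbhds_def base_nbhd_def)
  show ?thesis
  proof
    fix x m assume x: "x \<in> P {}"
    then obtain a where a: "x = Inl a" "a \<in> P0" by (auto simp: P)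
    show "N {} x m \<subseteq> P {}" "x \<in> N {} x m" "N {} x (Suc m) \<subseteq> N {} x m"
      using a base.sub[of a m] base.self[of a m] base.dec[of a m] by (auto simp: P N)
    show "\<exists>k. N {} y k \<subseteq> N {} x m" if y: "y \<in> N {} x m" for y
    proof -
      obtain b where b: "y = Inl b" "b \<in> N0 a m" using y a by (auto simp: N)
      then have "b \<in> P0" using base.sub a by blast
      obtain k where "N0 b k \<subseteq> N0 a m" using base.op a b by blast
      then show ?thesis using a b N \<open>b \<in> P0\<close> by (intro exI[of _ k]) auto
    qed
    fix y assume "y \<in> P {}"
    then obtain b where b: "y = Inl b" "b \<in> P0" by (auto simp: P)
    show "\<exists>k. N {} y k \<inter> N {} x (Suc m) = {}" if yx: "y \<notin> N {} x m"
    proof -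
      have "b \<notin> N0 a m" using yx a b by (auto simp: N)
      then obtain k where "N0 b k \<inter> N0 a (Suc m) = {}" using base.reg a b by blast
      then show ?thesis using a b N by (intro exI[of _ k]) auto
    qed
    show "\<exists>m. y \<notin> N {} x m" if xy: "x \<noteq> y"
    proof -
      obtain m where "b \<notin> N0 a m" using base.sep[of a b] xy a b by blast
      then show ?thesis using a b N by (intro exI[of _ m]) auto
    qed
  qed
qed

section \<open>Persistence of inclusions and disjointness along the tower\<close>

context
  fixes I J
  assumes I: "initial I" and J: "initial J" "J \<subseteq> I"
    and goodI: "\<forall>\<gamma>\<in>I. good \<gamma>"
    and sysJ: "nbhd_system (P J) (N J)"
begin

lemma J_before: "\<delta> \<notin> J \<Longrightarrow> J \<subseteq> before \<delta>"
proof
  fix \<gamma> assume d: "\<delta> \<notin> J" and g: "\<gamma> \<in> J"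
  then have "\<gamma> \<noteq> \<delta>" "\<delta> \<notin> before \<gamma>" using J(1) by (auto simp: initial_def)
  then show "\<gamma> \<in> before \<delta>" using before_total[of \<gamma> \<delta>] by simp
qed

text \<open>When a later point \<delta> enters the smaller set, the two sets just before \<delta>
  are nested by induction, so closure of \<open>C \<delta>\<close> under larger sets puts \<delta>
  into the larger set as well.\<close>

lemma persist_subset:
  assumes xy: "x \<in> P J" "y \<in> P J" and sub: "N J y k \<subseteq> N J x m"
  shows "N I y k \<subseteq> N I x m"
proof -
  have C: "\<delta> \<in> I \<Longrightarrow> \<delta> \<notin> J \<Longrightarrow> \<delta> \<in> active \<Longrightarrow> (y, k) \<in> C \<delta> \<Longrightarrow> (x, m) \<in> C \<delta>" for \<delta>
  proof (induction \<delta> rule: before_induct)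
    case (less \<delta>)
    note Jd = J_before[OF less.prems(2)]
    have "before \<delta> \<subseteq> I" using I less.prems by (simp add: initial_def)
    then have "Inr ` {\<gamma> \<in> (before \<delta> - J) \<inter> active. (y, k) \<in> C \<gamma>} \<subseteq> Inr ` {\<gamma> \<in> (before \<delta> - J) \<inter> active. (x, m) \<in> C \<gamma>}"
      using less.IH by blast
    then have "N (before \<delta>) y k \<subseteq> N (before \<delta>) x m"
      unfolding nbhds_extend[OF Jd xy(1)] nbhds_extend[OF Jd xy(2)] by (rule Un_mono[OF sub])
    moreover have "x \<in> P (before \<delta>)" "y \<in> P (before \<delta>)" using points_mono[OF Jd] xy by auto
    ultimately show ?case
      using good_extD[OF bspec[OF goodI less.prems(1)] less.prems(3)] less.prems(4) unfolding good_ext_def by blast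
  qed
  then have "Inr ` {\<gamma> \<in> (I - J) \<inter> active. (y, k) \<in> C \<gamma>} \<subseteq> Inr ` {\<gamma> \<in> (I - J) \<inter> active. (x, m) \<in> C \<gamma>}" by blast
  then show ?thesis
    unfolding nbhds_extend[OF J(2) xy(1)] nbhds_extend[OF J(2) xy(2)] by (rule Un_mono[OF sub])
qed

lemma outside_J: "x \<in> P J \<Longrightarrow> N J x m \<inter> Inr ` (T - J) = {}"
  using nbhd_system.sub[OF sysJ, of x m] by (auto simp: points_def)

lemma persist_disjoint:
  assumes xy: "x \<in> P J" "y \<in> P J" and disj: "N J y k \<inter> N J x m = {}"
  shows "N I y k \<inter> N I x m = {}"
proof -
  \<comment> \<open>\<open>U\<close> will be the set of points added after \<open>J\<close>; it
    separates old parts from new ones, so mixed intersections are empty.\<close>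
  have disjoint_Un: "S1 \<inter> S2 = {} \<Longrightarrow> T1 \<inter> T2 = {} \<Longrightarrow> T1 \<subseteq> U \<Longrightarrow> T2 \<subseteq> U \<Longrightarrow> S2 \<inter> U = {} \<Longrightarrow>
      S1 \<inter> U = {} \<Longrightarrow> (S1 \<union> T1) \<inter> (S2 \<union> T2) = {}" for S1 S2 T1 T2 U :: "('a + real) set" by blast
  have step: "N T y k \<inter> N T x m = {}"
    if T: "J \<subseteq> T" and no: "\<And>\<gamma>. \<gamma> \<in> T - J \<Longrightarrow> \<gamma> \<in> active \<Longrightarrow> \<not> ((y, k) \<in> C \<gamma> \<and> (x, m) \<in> C \<gamma>)" for T
  proof -
    have "Inr ` {\<gamma> \<in> (T - J) \<inter> active. (y, k) \<in> C \<gamma>} \<inter> Inr ` {\<gamma> \<in> (T - J) \<inter> active. (x, m) \<in> C \<gamma>} = ({} :: ('a + real) set)"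
      using no by auto
    moreover have "Inr ` {\<gamma> \<in> (T - J) \<inter> active. (y, k) \<in> C \<gamma>} \<subseteq> (Inr ` (T - J) :: ('a + real) set)"
      "Inr ` {\<gamma> \<in> (T - J) \<inter> active. (x, m) \<in> C \<gamma>} \<subseteq> (Inr ` (T - J) :: ('a + real) set)" by auto
    ultimately show ?thesis
      unfolding nbhds_extend[OF T xy(1)] nbhds_extend[OF T xy(2)]
      by (rule disjoint_Un[OF disj _ _ _ outside_J[OF xy(1), of m T] outside_J[OF xy(2), of k T]])
  qed
  have "\<delta> \<in> I \<Longrightarrow> \<delta> \<notin> J \<Longrightarrow> \<delta> \<in> active \<Longrightarrow> \<not> ((y, k) \<in> C \<delta> \<and> (x, m) \<in> C \<delta>)" for \<delta>
  proof (induction \<delta> rule: before_induct)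
    case (less \<delta>)
    note Jd = J_before[OF less.prems(2)]
    have "before \<delta> \<subseteq> I" using I less.prems by (simp add: initial_def)
    then have "N (before \<delta>) y k \<inter> N (before \<delta>) x m = {}"
      using less.IH by (intro step Jd) blast
    moreover have "x \<in> P (before \<delta>)" "y \<in> P (before \<delta>)" using points_mono[OF Jd] xy by auto
    ultimately show ?case
      using good_extD[OF bspec[OF goodI less.prems(1)] less.prems(3)] unfolding good_ext_def by blast
  qed
  then show ?thesis by (intro step J) blast
qed

end

text \<open>Two points are both present right after the later of them, or in the base, where the
  axioms are known without any appeal to limits.\<close>

lemma stage_containing:
  assumes I: "initial I" and goodI: "\<forall>\<gamma>\<in>I. good \<gamma>" and xy: "x \<in> P I" "y \<in> P I"
  shows "\<exists>J. initial J \<and> J \<subseteq> I \<and> x \<in> P J \<and> y \<in> P J \<and> nbhd_system (P J) (N J)"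
proof -
  have succ: "initial (insert \<gamma> (before \<gamma>)) \<and> insert \<gamma> (before \<gamma>) \<subseteq> I \<and>
      nbhd_system (P (insert \<gamma> (before \<gamma>))) (N (insert \<gamma> (before \<gamma>)))" if "\<gamma> \<in> I" "\<gamma> \<in> active" for \<gamma>
  proof (intro conjI initial_before succ_stage)
    show "insert \<gamma> (before \<gamma>) \<subseteq> I" "good \<gamma>" "\<And>\<delta>. \<delta> \<in> before \<gamma> \<Longrightarrow> good \<delta>"
      using that I goodI by (auto simp: initial_def)
  qed (rule that(2))
  show ?thesis
  proof (cases x; cases y)
    fix a b assume "x = Inl a" "y = Inl b"
    then show ?thesis using xy base_stage by (intro exI[of _ "{}"]) (auto simp: initial_def)
  next
    fix a \<gamma> assume "x = Inl a" "y = Inr \<gamma>"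
    then show ?thesis using xy succ[of \<gamma>] by (intro exI[of _ "insert \<gamma> (before \<gamma>)"]) auto
  next
    fix a \<gamma> assume "x = Inr \<gamma>" "y = Inl a"
    then show ?thesis using xy succ[of \<gamma>] by (intro exI[of _ "insert \<gamma> (before \<gamma>)"]) auto
  next
    fix \<gamma> \<delta> assume e: "x = Inr \<gamma>" "y = Inr \<delta>"
    from before_total[of \<gamma> \<delta>] consider "\<gamma> \<in> insert \<delta> (before \<delta>)" | "\<delta> \<in> insert \<gamma> (before \<gamma>)" by blast
    then show ?thesis
    proof cases
      case 1
      then show ?thesis using e xy succ[of \<delta>] by (intro exI[of _ "insert \<delta> (before \<delta>)"]) auto
    next
      case 2
      then show ?thesis using e xy succ[of \<gamma>] by (intro exI[of _ "insert \<gamma> (before \<gamma>)"]) auto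
    qed
  qed
qed

text \<open>Each axiom is taken from a stage containing the two points concerned and carried up by
  persistence; successor and limit stages need no distinction.\<close>

lemma nbhd_system_initial:
  assumes I: "initial I" and goodI: "\<forall>\<gamma>\<in>I. good \<gamma>"
  shows "nbhd_system (P I) (N I)"
proof
  fix x m assume x: "x \<in> P I"
  obtain J where J: "initial J" "J \<subseteq> I" "x \<in> P J" "nbhd_system (P J) (N J)"
    using stage_containing[OF I goodI x x] by blast
  show sub: "N I x m \<subseteq> P I"
  proof -
    have "N J x m \<subseteq> P I" using nbhd_system.sub[OF J(4,3)] points_mono[OF J(2)] by blast
    then show ?thesis unfolding nbhds_extend[OF J(2,3)] by auto
  qed
  show "x \<in> N I x m"
    unfolding nbhds_extend[OF J(2,3)] using nbhd_system.self[OF J(4,3)] by blast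
  show "N I x (Suc m) \<subseteq> N I x m"
    by (rule persist_subset[OF I J(1,2) goodI J(4,3,3) nbhd_system.dec[OF J(4,3)]])
  have old: "y \<in> N J x m" if y: "y \<in> N I x m" "y \<in> P J" "J \<subseteq> I" "x \<in> P J" for y J m
    using y(1,2) unfolding nbhds_extend[OF y(3,4)] by auto
  show "\<exists>k. N I y k \<subseteq> N I x m" if y: "y \<in> N I x m" for y
  proof -
    have "y \<in> P I" using y sub by blast
    then obtain J where J: "initial J" "J \<subseteq> I" "x \<in> P J" "y \<in> P J" "nbhd_system (P J) (N J)"
      using stage_containing[OF I goodI x] by blast
    obtain k where "N J y k \<subseteq> N J x m"
      using nbhd_system.op[OF J(5,3) old[OF y J(4,2,3)]] by blast
    then have "N I y k \<subseteq> N I x m" by (rule persist_subset[OF I J(1,2) goodI J(5,3,4)])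
    then show ?thesis ..
  qed
  fix y assume y: "y \<in> P I"
  obtain J where J: "initial J" "J \<subseteq> I" "x \<in> P J" "y \<in> P J" "nbhd_system (P J) (N J)"
    using stage_containing[OF I goodI x y] by blast
  show "\<exists>k. N I y k \<inter> N I x (Suc m) = {}" if "y \<notin> N I x m"
  proof -
    have "y \<notin> N J x m" using that nbhds_extend[OF J(2,3)] by blast
    then obtain k where "N J y k \<inter> N J x (Suc m) = {}"
      using nbhd_system.reg[OF J(5,3,4)] by blast
    then have "N I y k \<inter> N I x (Suc m) = {}" by (rule persist_disjoint[OF I J(1,2) goodI J(5,3,4)])
    then show ?thesis ..
  qed
  show "\<exists>m. y \<notin> N I x m" if xy: "x \<noteq> y"
  proof -
    obtain m where "y \<notin> N J x m" using nbhd_system.sep[OF J(5,3,4) xy] by blast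
    then have "y \<notin> N I x m" using old J by blast
    then show ?thesis ..
  qed
qed

lemma points_small:
  assumes "|I| <o continuum"
  shows "|P I| <o continuum"
proof -
  have "|Inl ` P0 :: ('a + real) set| <o continuum"
    using card_of_image P0_small by (rule ordLeq_ordLess_trans)
  moreover have "|Inr ` (I \<inter> active) :: ('a + real) set| <o continuum"
    by (rule ordLeq_ordLess_trans[OF card_of_image ordLeq_ordLess_trans[OF card_of_mono1[OF Int_lower1] assms]])
  ultimately show ?thesis
    unfolding points_def by (rule card_of_Un_ordLess_infinite_Field[OF infinite_continuum])
qed

lemma all_good: "good \<alpha>"
proof (induction \<alpha> rule: before_induct)
  case (less \<alpha>)
  let ?P = "P (before \<alpha>)" and ?N = "N (before \<alpha>)"
  have sys: "nbhd_system ?P ?N" using less by (intro nbhd_system_initial initial_before) blast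
  have "\<exists>v. valid ?P ?N \<alpha> v"
  proof (cases "inj (\<phi> \<alpha>) \<and> range (\<phi> \<alpha>) \<subseteq> ?P \<and> (\<forall>y\<in>?P. \<exists>m. finite {n. \<phi> \<alpha> n \<in> ?N y m})")
    case True
    have "Inr \<alpha> \<notin> ?P" using before_irrefl by simp
    then obtain L' C' where "good_ext ?P ?N (Inr \<alpha>) (\<phi> \<alpha>) L' C'"
      using nbhd_system.good_ext_exists[OF sys points_small[OF before_small] bounded unsplit, of "Inr \<alpha>" "\<phi> \<alpha>"] True
      by auto
    then have "valid ?P ?N \<alpha> (True, L', C')" using True by (simp add: valid_def)
    then show ?thesis ..
  next
    case False
    \<comment> \<open>An inactive stage adds no point, and its other components enter no
      neighbourhood.\<close>
    then have "valid ?P ?N \<alpha> (False, undefined)" unfolding valid_def by simp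
    then show ?thesis ..
  qed
  then show ?case
    unfolding good_def by (subst hist_eq) (unfold next_stage_def, rule someI_ex)
qed

sublocale nbhd_system "P UNIV" "N UNIV"
  by (rule nbhd_system_initial) (auto simp: initial_def all_good)

lemma new_point_nbhd:
  assumes "\<gamma> \<in> active"
  shows "infinite {n. \<phi> \<gamma> n \<in> N UNIV (Inr \<gamma>) m}"
proof -
  have "infinite {n. \<phi> \<gamma> n \<in> L \<gamma> m}"
    using good_extD[OF all_good assms] by (simp add: good_ext_def)
  moreover have "L \<gamma> m \<subseteq> N UNIV (Inr \<gamma>) m"
    using assms by (auto simp: nbhds_def base_nbhd_def)
  then have "{n. \<phi> \<gamma> n \<in> L \<gamma> m} \<subseteq> {n. \<phi> \<gamma> n \<in> N UNIV (Inr \<gamma>) m}" by blast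
  ultimately show ?thesis using finite_subset by blast
qed

lemma old_point_nbhd: "a \<in> P0 \<Longrightarrow> Inl ` N0 a m \<subseteq> N UNIV (Inl a) m"
  by (auto simp: nbhds_def base_nbhd_def)

text \<open>A neighbourhood of a new point contains a neighbourhood of some term of its sequence,
  which is an earlier point; induction on the stage ends in \<open>P0\<close>.\<close>

lemma dense:
  assumes Q: "\<And>a m. a \<in> P0 \<Longrightarrow> N0 a m \<inter> Q \<noteq> {}"
  shows "x \<in> P UNIV \<Longrightarrow> N UNIV x m \<inter> Inl ` Q \<noteq> {}"
proof -
  have old: "N UNIV (Inl a) m \<inter> Inl ` Q \<noteq> {}" if "a \<in> P0" for a m
    using Q[OF that, of m] old_point_nbhd[OF that, of m] by blast
  have new: "\<forall>m. \<gamma> \<in> active \<longrightarrow> N UNIV (Inr \<gamma>) m \<inter> Inl ` Q \<noteq> {}" for \<gamma>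
  proof (induction \<gamma> rule: before_induct)
    case (less \<gamma>)
    show ?case
    proof (intro allI impI)
      fix m assume g: "\<gamma> \<in> active"
      have g': "Inr \<gamma> \<in> P UNIV" using g by simp
      obtain n where n: "\<phi> \<gamma> n \<in> N UNIV (Inr \<gamma>) m"
        using new_point_nbhd[OF g, of m] by (metis (mono_tags) Collect_empty_eq finite.emptyI)
      obtain k where k: "N UNIV (\<phi> \<gamma> n) k \<subseteq> N UNIV (Inr \<gamma>) m" using op[OF g' n] by blast
      have "\<phi> \<gamma> n \<in> P (before \<gamma>)"
        using all_good[of \<gamma>] g unfolding good_def valid_def act_def by blast
      then have "N UNIV (\<phi> \<gamma> n) k \<inter> Inl ` Q \<noteq> {}"
        using old less by (cases "\<phi> \<gamma> n") auto
      with k show "N UNIV (Inr \<gamma>) m \<inter> Inl ` Q \<noteq> {}" by blast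
    qed
  qed
  show "N UNIV x m \<inter> Inl ` Q \<noteq> {}" if "x \<in> P UNIV"
    using that old new by (cases x) auto
qed

text \<open>All terms of \<open>s\<close> appear before some stage, and the bookkeeping returns to
  \<open>s\<close> later. Then either a limit point is added, or the stage is inactive because there
  is one already; it stays one, as neighbourhoods only grow.\<close>

lemma accumulation:
  fixes s :: "nat \<Rightarrow> 'a + real"
  assumes \<phi>: "\<And>s \<alpha>. \<exists>\<beta>. \<alpha> \<in> before \<beta> \<and> \<phi> \<beta> = s"
    and s: "inj s" "range s \<subseteq> P UNIV"
  shows "\<exists>y\<in>P UNIV. \<forall>m. infinite {n. s n \<in> N UNIV y m}"
proof -
  have "countable {\<gamma>. Inr \<gamma> \<in> range s}"
  proof -
    have "Inr ` {\<gamma>. Inr \<gamma> \<in> range s} \<subseteq> range s" by blast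
    then have "countable (Inr ` {\<gamma>. Inr \<gamma> \<in> range s} :: ('a + real) set)"
      by (rule countable_subset) simp
    then show ?thesis by (rule countable_image_inj_on) simp
  qed
  then obtain \<alpha> where \<alpha>: "{\<gamma>. Inr \<gamma> \<in> range s} \<subseteq> before \<alpha>"
    using small_bounded_cofinality[OF bounded] by blast
  obtain \<beta> where \<beta>: "\<alpha> \<in> before \<beta>" "\<phi> \<beta> = s" using \<phi> by blast
  have sP: "range s \<subseteq> P (before \<beta>)"
  proof
    fix x assume x: "x \<in> range s"
    then have "x \<in> P UNIV" using s by blast
    moreover have "\<gamma> \<in> before \<beta>" if "x = Inr \<gamma>" for \<gamma>
    proof (rule before_trans[OF _ \<beta>(1)])
      have "\<gamma> \<in> {\<gamma>. Inr \<gamma> \<in> range s}" using x unfolding that by (rule CollectI)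
      with \<alpha> show "\<gamma> \<in> before \<alpha>" by (rule subsetD)
    qed
    ultimately show "x \<in> P (before \<beta>)" by (cases x) auto
  qed
  show ?thesis
  proof (cases "\<beta> \<in> active")
    case True
    then show ?thesis using new_point_nbhd[OF True] \<beta>(2) by (intro bexI[of _ "Inr \<beta>"]) auto
  next
    case False
    then have "\<not> (\<forall>y\<in>P (before \<beta>). \<exists>m. finite {n. s n \<in> N (before \<beta>) y m})"
      using all_good[of \<beta>] s sP \<beta>(2) unfolding good_def valid_def act_def by simp
    then obtain y where y: "y \<in> P (before \<beta>)" "\<And>m. infinite {n. s n \<in> N (before \<beta>) y m}" by blast
    have "{n. s n \<in> N (before \<beta>) y m} \<subseteq> {n. s n \<in> N UNIV y m}" for m
      using nbhds_extend[OF subset_UNIV y(1), of m] by blast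
    then have "infinite {n. s n \<in> N UNIV y m}" for m using y(2) finite_subset by blast
    moreover have "y \<in> P UNIV" using y(1) points_mono by blast
    ultimately show ?thesis by blast
  qed
qed

end

section \<open>The rigid Nyikos space\<close>

context tower
begin

lemma Nyikos_space_nbhd_top:
  assumes \<phi>: "\<And>s \<alpha>. \<exists>\<beta>. \<alpha> \<in> before \<beta> \<and> \<phi> \<beta> = s"
    and Q: "countable Q" "Q \<subseteq> P0" "\<And>a m. a \<in> P0 \<Longrightarrow> N0 a m \<inter> Q \<noteq> {}"
  shows "Nyikos_space nbhd_top"
  unfolding Nyikos_space_def
proof (intro conjI Hausdorff_top regular_top first_countable_top)
  show "separable_space nbhd_top"
  proof (rule separable_top)
    show "countable (Inl ` Q :: ('a + real) set)" using Q(1) by simp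
    show "Inl ` Q \<subseteq> P UNIV" using Q(2) by auto
  qed (rule dense[OF Q(3)])
  show "countably_compact_space nbhd_top"
    using accumulation[OF \<phi>] by (rule countably_compact_top)
qed

lemma R_rigid_nbhd_top:
  assumes Q: "Q \<subseteq> P0" "\<And>a m. a \<in> P0 \<Longrightarrow> N0 a m \<inter> Q \<noteq> {}" and rigid: "rigid_nbhds P0 N0"
  shows "R_rigid nbhd_top"
  unfolding R_rigid_def
proof (intro allI impI)
  fix f assume "continuous_map nbhd_top euclideanreal f"
  then have f: "\<And>x e. x \<in> P UNIV \<Longrightarrow> e > 0 \<Longrightarrow> \<exists>m. \<forall>y\<in>N UNIV x m. \<bar>f y - f x\<bar> < e"
    unfolding continuous_map_top by blast
  have "\<exists>m. \<forall>b\<in>N0 a m. \<bar>f (Inl b) - f (Inl a)\<bar> < e" if a: "a \<in> P0" "e > 0" for a e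
  proof -
    obtain m where "\<forall>y\<in>N UNIV (Inl a) m. \<bar>f y - f (Inl a)\<bar> < e" using f[of "Inl a" e] a by auto
    then have "\<forall>b\<in>N0 a m. \<bar>f (Inl b) - f (Inl a)\<bar> < e" using old_point_nbhd[OF a(1), of m] by blast
    then show ?thesis ..
  qed
  then obtain c where c: "\<And>a. a \<in> P0 \<Longrightarrow> f (Inl a) = c"
    using rigid[unfolded rigid_nbhds_def, rule_format, of "\<lambda>a. f (Inl a)"] by blast
  have "f x = c" if x: "x \<in> P UNIV" for x
  proof (rule ccontr)
    assume "f x \<noteq> c"
    then obtain m where m: "\<forall>y\<in>N UNIV x m. \<bar>f y - f x\<bar> < \<bar>f x - c\<bar>" using f[OF x, of "\<bar>f x - c\<bar>"] by auto
    obtain q where "q \<in> Q" "Inl q \<in> N UNIV x m" using dense[OF Q(2) x, of m] by blast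
    then show False using m c Q(1) by fastforce
  qed
  then show "\<exists>c. \<forall>x\<in>topspace nbhd_top. f x = c" by auto
qed

end

section \<open>Transfer to a topology on the reals\<close>

lemma R_rigid_homeomorphic:
  assumes "X homeomorphic_space Y" "R_rigid X"
  shows "R_rigid Y"
  unfolding R_rigid_def
proof (intro allI impI)
  fix f assume f: "continuous_map Y euclideanreal f"
  obtain g h where gh: "homeomorphic_maps X Y g h"
    using assms(1) by (auto simp: homeomorphic_space_def)
  then have "continuous_map X euclideanreal (f \<circ> g)"
    using f by (auto simp: homeomorphic_maps_def intro: continuous_map_compose)
  then obtain c where c: "\<forall>x\<in>topspace X. f (g x) = c" using assms(2) unfolding R_rigid_def comp_def by blast
  have "f y = c" if "y \<in> topspace Y" for y
  proof -
    have "h y \<in> topspace X" "g (h y) = y"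
      using gh that by (auto simp: homeomorphic_maps_def continuous_map_def)
    with c show ?thesis by metis
  qed
  then show "\<exists>c. \<forall>x\<in>topspace Y. f x = c" by blast
qed

lemma countably_compact_space_homeomorphic:
  assumes "X homeomorphic_space Y" "countably_compact_space X"
  shows "countably_compact_space Y"
  unfolding countably_compact_space_def
proof (intro allI impI)
  fix D assume D: "closedin Y D \<and> subtopology Y D = discrete_topology D"
  obtain k where k: "homeomorphic_map Y X k"
    using assms(1) homeomorphic_space homeomorphic_space_sym by blast
  have DY: "D \<subseteq> topspace Y" using D closedin_subset by blast
  have kD: "k ` D \<subseteq> topspace X"
    using homeomorphic_imp_surjective_map[OF k] DY by blast
  have inj: "inj_on k D"
    using homeomorphic_imp_injective_map[OF k] DY inj_on_subset by blast
  have "closedin X (k ` D)"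
    using homeomorphic_map_closedness[OF k DY] D by blast
  moreover have "subtopology X (k ` D) = discrete_topology (k ` D)"
  proof -
    have hm: "homeomorphic_map (subtopology Y D) (subtopology X (k ` D)) k"
      using k by (rule homeomorphic_map_subtopologies) (use DY kD in blast)
    have "openin (subtopology X (k ` D)) {x}" if x: "x \<in> k ` D" for x
    proof -
      obtain d where d: "d \<in> D" "x = k d" using x by blast
      then have "openin (subtopology Y D) {d}" using D by simp
      moreover have "{d} \<subseteq> topspace (subtopology Y D)" using d DY by auto
      ultimately have "openin (subtopology X (k ` D)) (k ` {d})"
        using homeomorphic_map_openness[OF hm] by blast
      then show ?thesis using d by simp
    qed
    moreover have "topspace (subtopology X (k ` D)) = k ` D" using kD by auto
    ultimately show ?thesis using discrete_topology_unique[of "k ` D" "subtopology X (k ` D)"] by metis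
  qed
  ultimately have "finite (k ` D)" using assms(2) by (simp add: countably_compact_space_def)
  then show "finite D" using inj by (rule finite_imageD)
qed

lemma Nyikos_space_homeomorphic:
  assumes "X homeomorphic_space Y" "Nyikos_space X"
  shows "Nyikos_space Y"
  using assms countably_compact_space_homeomorphic[OF assms(1)]
    homeomorphic_Hausdorff_space[OF assms(1)] homeomorphic_regular_space[OF assms(1)]
    homeomorphic_separable_space[OF assms(1)] homeomorphic_space_first_countability[OF assms(1)]
  by (simp add: Nyikos_space_def)

text \<open>The two distinct points exclude the empty and the one-point space, which are trivially
  rigid.\<close>

theorem theorem3p6:
  assumes "omega1 <o bounding_number"
    and "bounding_number =o splitting_number"
    and "splitting_number =o continuum"
  shows "\<exists>X :: real topology. Nyikos_space X \<and> R_rigid X \<and>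
           (\<exists>x\<in>topspace X. \<exists>y\<in>topspace X. x \<noteq> y)"
proof -
  obtain P0 :: "((cell \<times> nat) + nat set) set" and N0 Q where
    sys: "nbhd_system P0 N0" and rigid: "rigid_nbhds P0 N0" and small: "|P0| \<le>o omega1"
    and Q: "countable Q" "Q \<subseteq> P0" "\<And>x m. x \<in> P0 \<Longrightarrow> N0 x m \<inter> Q \<noteq> {}"
    and two: "\<exists>x\<in>P0. \<exists>y\<in>P0. x \<noteq> y"
    using rigid_nbhd_system_exists by (elim exE conjE) metis
  obtain j :: "real \<Rightarrow> nat set" where j: "inj j"
    using nat_sets_eqpoll_reals[THEN eqpoll_sym] by (auto simp: eqpoll_def bij_betw_def)
  \<comment> \<open>The type of all possible points has size at most \<cc>, as the bookkeeping of
    its sequences demands.\<close>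
  have "|UNIV :: (((cell \<times> nat) + nat set) + real) set| \<le>o |UNIV :: nat set set|"
  proof -
    have inf: "\<not> finite (Field |UNIV :: nat set set| )" "Card_order |UNIV :: nat set set|"
      by (simp_all add: Field_card_of card_of_card_order_on Finite_Set.finite_set)
    have "|UNIV :: (cell \<times> nat) set| \<le>o |UNIV :: nat set set|"
      by (subst card_of_ordLeq[symmetric], rule exI[of _ "\<lambda>q. {to_nat q}"]) (auto simp: inj_def)
    then have "|(UNIV :: (cell \<times> nat) set) <+> (UNIV :: nat set set)| \<le>o |UNIV :: nat set set|"
      using ordIso_imp_ordLeq[OF card_of_refl] inf(2) by (rule card_of_Plus_ordLeq_infinite_Field[OF inf(1)])
    moreover have "|UNIV :: real set| \<le>o |UNIV :: nat set set|"
      using j by (subst card_of_ordLeq[symmetric]) auto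
    ultimately have "|((UNIV :: (cell \<times> nat) set) <+> (UNIV :: nat set set)) <+> (UNIV :: real set)| \<le>o |UNIV :: nat set set|"
      using inf(2) by (rule card_of_Plus_ordLeq_infinite_Field[OF inf(1)])
    then show ?thesis by (simp add: UNIV_Plus_UNIV)
  qed
  then obtain e :: "((cell \<times> nat) + nat set) + real \<Rightarrow> nat set" where "inj e"
    using card_of_ordLeq[of "UNIV :: (((cell \<times> nat) + nat set) + real) set" "UNIV :: nat set set"] by blast
  then obtain \<phi> :: "real \<Rightarrow> nat \<Rightarrow> ((cell \<times> nat) + nat set) + real"
    where \<phi>: "\<And>s \<alpha>. \<exists>\<beta>. \<alpha> \<in> before \<beta> \<and> \<phi> \<beta> = s"
    using bookkeeping by metis
  \<comment> \<open>This is where \<open>omega1 <o bounding_number\<close> enters.\<close>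
  have "|P0| <o continuum"
    using small assms ordLeq_ordLess_trans ordLess_ordIso_trans by metis
  then interpret tower P0 N0 \<phi>
    using sys small_bounded_if_b_eq_c[OF assms(2,3)] small_unsplit_if_s_eq_c[OF assms(3)]
    by (simp add: tower_def tower_axioms_def)
  have Ny: "Nyikos_space nbhd_top" using \<phi> Q by (rule Nyikos_space_nbhd_top)
  then obtain Y :: "real topology" where Y: "nbhd_top homeomorphic_space Y"
    using Nyikos_space_on_reals by blast
  have "Nyikos_space Y" using Y Ny by (rule Nyikos_space_homeomorphic)
  moreover have "R_rigid Y"
    using Y R_rigid_nbhd_top[OF Q(2,3) rigid] by (rule R_rigid_homeomorphic)
  moreover have "\<exists>x\<in>topspace Y. \<exists>y\<in>topspace Y. x \<noteq> y"
  proof -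
    obtain x y where xy: "x \<in> P0" "y \<in> P0" "x \<noteq> y" using two by blast
    obtain g h where gh: "homeomorphic_maps nbhd_top Y g h"
      using Y by (auto simp: homeomorphic_space_def)
    then have "g (Inl x) \<in> topspace Y" "g (Inl y) \<in> topspace Y" "g (Inl x) \<noteq> g (Inl y)"
      using xy unfolding homeomorphic_maps_def continuous_map_def topspace_top
      by (auto simp: Pi_iff) (metis points_simps(1) sum.inject(1))
    then show ?thesis by blast
  qed
  ultimately show ?thesis by blast
qed

end
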